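(* Let $k=k(n)$, $r=r(n)$ and $l=l(n)$ be nonnegative integer functions and $\rho=\rho(n)\in(0,1]$ a real function, where $2\leq r\leq n/k$. Let $d=\left\lceil\frac{n-r(k+l-1)}{r-1}\right\rceil\geq 2$ and $t=\left\lceil\binom{k+l}{k}/(d-1)\right\rceil$. Then almost surely $\chi(\operatorname{KG}^r_{n,k}(\rho))\geq d$, provided that at least one of the following holds as $n\to\infty$: (I) $n\ln(r+1)+rt(1+\ln(d-1))-\rho t^r\to-\infty$; (II) $r(k+l)(\ln n+1)+rt(1+\ln(d-1))-\rho t^r\to-\infty$.
   Context: For positive integers $n,k$ and $r\geq2$, the Kneser hypergraph $\operatorname{KG}^r_{n,k}$ has vertex set $\binom{[n]}{k}$ (all $k$-subsets of $[n]=\{1,\dots,n\}$), and its edges are the $r$-sets $\{e_1,\dots,e_r\}$ of pairwise disjoint $k$-subsets. For $\rho\in(0,1]$, $\operatorname{KG}^r_{n,k}(\rho)$ is the random spanning subhypergraph containing each edge of $\operatorname{KG}^r_{n,k}$ independently with probability $\rho$. The chromatic number $\chi$ of a hypergraph is the least number of colors in a vertex coloring with no monochromatic edge. "Almost surely" means with probability tending to $1$ as $n\to\infty$. *)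

theory Defs
  imports "HOL-Probability.Probability" "HOL-Probability.Product_PMF"
begin

text \<open>A hypergraph is a pair of its vertex set and its edge set.\<close>

type_synonym 'v hypergraph = "'v set \<times> 'v set set"

definition kneser_vertices :: "nat \<Rightarrow> nat \<Rightarrow> nat set set" where
  "kneser_vertices n k = {e. e \<subseteq> {1..n} \<and> card e = k}"

definition kneser_edges :: "nat \<Rightarrow> nat \<Rightarrow> nat \<Rightarrow> nat set set set" where
  "kneser_edges r n k = {E. E \<subseteq> kneser_vertices n k \<and> card E = r \<and> pairwise disjnt E}"

definition random_kneser :: "nat \<Rightarrow> nat \<Rightarrow> nat \<Rightarrow> real \<Rightarrow> nat set hypergraph pmf" where
  "random_kneser r n k \<rho> =
     map_pmf (\<lambda>b. (kneser_vertices n k, {E \<in> kneser_edges r n k. b E}))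
       (Pi_pmf (kneser_edges r n k) False (\<lambda>_. bernoulli_pmf \<rho>))"

definition proper_coloring :: "'v hypergraph \<Rightarrow> nat \<Rightarrow> ('v \<Rightarrow> nat) \<Rightarrow> bool" where
  "proper_coloring H m c \<longleftrightarrow>
     (\<forall>v\<in>fst H. c v < m) \<and> (\<forall>E\<in>snd H. \<not> (\<exists>i. \<forall>v\<in>E. c v = i))"

text \<open>If the vertex set is finite and each edge is a set of at least two vertices, a proper
  coloring exists, so the minimum below is attained.\<close>

definition chromatic_number :: "'v hypergraph \<Rightarrow> nat" where
  "chromatic_number H = (LEAST m. \<exists>c. proper_coloring H m c)"

end

theory Submission
  imports Defs "HOL-Number_Theory.Cong"
begin

text \<open>
  Suppose that \<open>c\<close> properly colours the random hypergraph with \<open>m = d - 1\<close> colours. Give each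
  \<open>(k + l)\<close>-set a colour that at least \<open>t\<close> of its \<open>k\<close>-subsets have. By the theorem of Alon, Frankl
  and Lovasz there are \<open>r\<close> disjoint \<open>(k + l)\<close>-sets with the same colour, so all the \<open>t\<^sup>r\<close> edges
  spanned by their popular \<open>k\<close>-subsets are absent; a union bound over these configurations shows
  that this is unlikely.

  For prime \<open>r = p\<close> the theorem of Alon, Frankl and Lovasz is proved by a chain-level version of
  Dold's theorem. Order the nonzero vectors in \<open>(\<int>\<^sub>p \<union> {0})\<^sup>n\<close> by extension. Every
  \<open>\<int>\<^sub>p\<close>-equivariant labelling of them by \<open>\<int>\<^sub>p\<close> admits a chain of length \<open>n\<close> in which consecutive labels
  differ: the generator of \<open>H\<^sup>n\<^sup>-\<^sup>1(\<int>\<^sub>p; \<int>\<^sub>p)\<close>, written as an explicit normalised cocycle on words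
  of labels, is nonzero on the image of an explicit equivariant chain. A colouring without \<open>p\<close>
  disjoint sets of the same colour yields a labelling together with a rank that increases
  whenever the label changes along the order, and the rank has too few values.
\<close>

section \<open>Cochains on words\<close>


text \<open>A word of length \<open>q\<close> is a simplex of dimension \<open>q - 1\<close>, and
  the empty word serves as augmentation. Behind a fixed first letter every deletion moves by one
  position, hence the minus sign.\<close>

fun coboundary :: "('a list \<Rightarrow> int) \<Rightarrow> 'a list \<Rightarrow> int" where
  "coboundary \<phi> [] = 0"
| "coboundary \<phi> (a # c) = \<phi> c - coboundary (\<lambda>d. \<phi> (a # d)) c"

text \<open>With \<open>x \<le> u x \<ge> v\<close>, the prism between the identity and \<open>u\<close> followed by the cone with apex \<open>v\<close>
  contracts the chains of a poset; here are the adjoint operators on cochains.\<close>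

fun prism :: "('a \<Rightarrow> 'a) \<Rightarrow> ('a list \<Rightarrow> int) \<Rightarrow> 'a list \<Rightarrow> int" where
  "prism u \<phi> [] = 0"
| "prism u \<phi> (a # c) = \<phi> (a # map u (a # c)) - prism u (\<lambda>d. \<phi> (a # d)) c"

definition cone_cochain :: "'a \<Rightarrow> ('a \<Rightarrow> 'a) \<Rightarrow> ('a list \<Rightarrow> int) \<Rightarrow> 'a list \<Rightarrow> int" where
  "cone_cochain v u \<phi> c = \<phi> (v # map u c) - prism u \<phi> c"

lemma coboundary_diff: "coboundary (\<lambda>c. \<phi> c - \<psi> c) c = coboundary \<phi> c - coboundary \<psi> c"
  by (induction c arbitrary: \<phi> \<psi>) auto

lemma coboundary_scale: "coboundary (\<lambda>c. x * \<phi> c) c = x * coboundary \<phi> c"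
  by (induction c arbitrary: \<phi>) (auto simp: algebra_simps)

lemma coboundary_sum: "coboundary (\<lambda>c. \<Sum>j\<in>J. \<phi> j c) c = (\<Sum>j\<in>J. coboundary (\<phi> j) c)"
  by (induction c arbitrary: \<phi>) (auto simp: sum_subtractf)

lemma coboundary_map: "coboundary (\<lambda>c. \<phi> (map f c)) c = coboundary \<phi> (map f c)"
  by (induction c arbitrary: \<phi>) auto

lemma prism_diff: "prism u (\<lambda>c. \<phi> c - \<psi> c) c = prism u \<phi> c - prism u \<psi> c"
  by (induction c arbitrary: \<phi> \<psi>) auto

lemma prism_scale: "prism u (\<lambda>c. x * \<phi> c) c = x * prism u \<phi> c"
  by (induction c arbitrary: \<phi>) (auto simp: algebra_simps)

text \<open>The words in the hypothesis are the simplices of the prism over \<open>c\<close>; this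
  later confines evaluations to chains of the poset.\<close>

lemma prism_cong:
  assumes "\<And>xs y ys. c = xs @ y # ys \<Longrightarrow> \<phi> (xs @ y # map u (y # ys)) = \<psi> (xs @ y # map u (y # ys))"
  shows "prism u \<phi> c = prism u \<psi> c"
  using assms
proof (induction c arbitrary: \<phi> \<psi>)
  case (Cons a c)
  have "prism u (\<lambda>d. \<phi> (a # d)) c = prism u (\<lambda>d. \<psi> (a # d)) c"
    by (rule Cons.IH) (use Cons.prems[of "a # xs" for xs] in auto)
  then show ?case
    using Cons.prems[of "[]" a c] by simp
qed auto

text \<open>The prism is a chain homotopy between the identity and \<open>map u\<close>; the
  induction fixes the first letter of the argument of \<open>\<phi>\<close>.\<close>

lemma prism_coboundary:
  "prism u (coboundary \<phi>) c + coboundary (prism u \<phi>) c = \<phi> (map u c) - \<phi> c"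
proof (induction c arbitrary: \<phi>)
  case (Cons a c)
  show ?case
    using Cons[of "\<lambda>d. \<phi> (a # d)"]
      coboundary_map[of "\<lambda>d. \<phi> (a # u a # d)" u c]
    by (simp add: coboundary_diff prism_diff)
qed auto

text \<open>The cone contracts the image of \<open>u\<close>, and the prism joins that image to the
  identity. The terms at \<open>map u c\<close> cancel, which leaves a contracting homotopy.\<close>

lemma cone_coboundary:
  "cone_cochain v u (coboundary \<phi>) = (\<lambda>c. \<phi> c - coboundary (cone_cochain v u \<phi>) c)"
proof
  fix c
  have "coboundary (cone_cochain v u \<phi>) c
      = coboundary (\<lambda>d. \<phi> (v # map u d)) c - coboundary (prism u \<phi>) c"
    unfolding cone_cochain_def[abs_def] by (rule coboundary_diff)
  then show "cone_cochain v u (coboundary \<phi>) c = \<phi> c - coboundary (cone_cochain v u \<phi>) c"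
    using prism_coboundary[of u \<phi> c] coboundary_map[of "\<lambda>d. \<phi> (v # d)" u c]
    by (simp add: cone_cochain_def)
qed

lemma cone_diff:
  "cone_cochain v u (\<lambda>c. \<phi> c - \<psi> c) = (\<lambda>c. cone_cochain v u \<phi> c - cone_cochain v u \<psi> c)"
  by (rule ext) (simp add: cone_cochain_def prism_diff)

lemma cone_scale: "cone_cochain v u (\<lambda>c. x * \<phi> c) = (\<lambda>c. x * cone_cochain v u \<phi> c)"
  by (rule ext) (simp add: cone_cochain_def prism_scale algebra_simps)

section \<open>Explicit cochains for the cohomology of the cyclic group\<close>

definition carry :: "int \<Rightarrow> int \<Rightarrow> int \<Rightarrow> int \<Rightarrow> int" where
  "carry p a b c = ((b - a) mod p + (c - b) mod p - (c - a) mod p) div p"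

text \<open>The division in \<open>carry\<close> is exact, since the residues of
  \<open>b - a\<close> and \<open>c - b\<close> add up to that of \<open>c - a\<close> modulo
  \<open>p\<close>. The right-hand side is the coboundary of the integral cochain
  \<open>(b - a) mod p\<close>.\<close>

lemma carry_mult: "p * carry p a b c = (b - a) mod p + (c - b) mod p - (c - a) mod p"
proof -
  have "(b - a) mod p + (c - b) mod p - (c - a) mod p
      = p * ((c - a) div p - (b - a) div p - (c - b) div p)"
    by (simp add: algebra_simps flip: minus_mult_div_eq_mod)
  then show ?thesis
    unfolding carry_def by (metis dvd_triv_left dvd_mult_div_cancel)
qed

text \<open>In even degree: the cup power of the carry cocycle, which represents the Bockstein of the
  identity class in \<open>H\<^sup>1(\<int>\<^sub>p; \<int>\<^sub>p)\<close>; words of even length get the junk value \<open>0\<close>.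
  In odd degree: its cup product with an integral lift of that class, whose coboundary is
  \<open>p\<close> times the next even cocycle.\<close>

fun even_cocycle :: "int \<Rightarrow> int list \<Rightarrow> int" where
  "even_cocycle p [] = 0"
| "even_cocycle p [a] = 1"
| "even_cocycle p [a, b] = 0"
| "even_cocycle p (a # b # c # r) = carry p a b c * even_cocycle p (c # r)"

fun odd_cochain :: "int \<Rightarrow> int list \<Rightarrow> int" where
  "odd_cochain p (a # b # r) = ((b - a) mod p) * even_cocycle p (b # r)"
| "odd_cochain p _ = 0"

text \<open>The carry is a cocycle, and so is the remaining factor by induction on a word two
  letters shorter; a product of cocycles is a cocycle.\<close>

lemma coboundary_even_cocycle:
  assumes "p > 0" "even (length c)"
  shows "coboundary (even_cocycle p) c = 0"
  using assms(2)
proof (induction c rule: length_induct)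
  case (1 xs)
  consider "xs = []" | a b where "xs = [a, b]" | a b c d r where "xs = a # b # c # d # r"
    using 1(2) by (cases xs; cases "tl xs"; cases "tl (tl xs)"; cases "tl (tl (tl xs))") auto
  then show ?case
  proof cases
    case (3 a b c d r)
    have "coboundary (even_cocycle p) (c # d # r) = 0"
      using 1(1)[rule_format, of "c # d # r"] 1(2) 3 by (simp del: coboundary.simps)
    then have A: "coboundary (\<lambda>x. even_cocycle p (c # x)) (d # r) = even_cocycle p (d # r)"
      by simp
    have B: "coboundary (\<lambda>x. even_cocycle p (a # b # c # x)) (d # r)
        = carry p a b c * even_cocycle p (d # r)"
      using A by (simp add: coboundary_scale del: coboundary.simps)
    \<comment> \<open>Times \<open>p\<close> the carry is itself a coboundary, so the residues
      cancel in pairs; \<open>p\<close> can then be divided out over the integers.\<close>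
    have "p * (carry p b c d - carry p a c d + carry p a b d - carry p a b c) = 0"
      unfolding distrib_left right_diff_distrib carry_mult by simp
    then have C: "carry p b c d - carry p a c d + carry p a b d - carry p a b c = 0"
      using assms(1) by simp
    have "coboundary (even_cocycle p) xs
       = (carry p b c d - carry p a c d + carry p a b d - carry p a b c) * even_cocycle p (d # r)"
      using B 3 by (simp add: algebra_simps)
    then show ?thesis using C by simp
  qed auto
qed

lemma coboundary_even_cocycle_Cons:
  assumes "p > 0" "odd (length c)"
  shows "coboundary (\<lambda>d. even_cocycle p (a # d)) c = even_cocycle p c"
  using coboundary_even_cocycle[of p "a # c"] assms by simp

text \<open>By the Leibniz rule only the coboundary of the integral lift survives, and this is
  \<open>p\<close> times the carry. In length 1 the two sides would be 0 and
  \<open>p\<close>.\<close>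

lemma coboundary_odd_cochain:
  assumes "p > 0" "odd (length c)" "length c \<noteq> 1"
  shows "coboundary (odd_cochain p) c = p * even_cocycle p c"
proof -
  obtain a b x r where c: "c = a # b # x # r"
    using assms(2,3) by (cases c; cases "tl c"; cases "tl (tl c)") auto
  have "coboundary (\<lambda>d. odd_cochain p (a # b # d)) (x # r) = (b - a) mod p * even_cocycle p (x # r)"
    using coboundary_even_cocycle_Cons[of p "x # r" b] assms c
    by (simp add: coboundary_scale del: coboundary.simps)
  then have "coboundary (odd_cochain p) c
      = ((b - a) mod p + (x - b) mod p - (x - a) mod p) * even_cocycle p (x # r)"
    unfolding c by (simp add: algebra_simps del: coboundary.simps(2))
      (simp add: algebra_simps)
  then show ?thesis
    unfolding c carry_mult[symmetric] by simp
qed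

text \<open>Modulo \<open>p\<close> the lift \<open>(b - a) mod p\<close> is the coboundary of
  \<open>hd\<close>, and the even factor is a cocycle.\<close>

lemma coboundary_hd_even_cocycle:
  assumes "p > 0" "even (length c)"
  shows "[coboundary (\<lambda>d. hd d * even_cocycle p d) c = odd_cochain p c] (mod p)"
proof (cases c)
  case (Cons a d)
  then obtain b r where c: "c = a # b # r"
    using assms(2) by (cases d) auto
  have "coboundary (\<lambda>d. a * even_cocycle p (a # d)) (b # r) = a * even_cocycle p (b # r)"
    using coboundary_even_cocycle_Cons[of p "b # r" a] assms c
    by (simp add: coboundary_scale del: coboundary.simps)
  then have "coboundary (\<lambda>d. hd d * even_cocycle p d) c = (b - a) * even_cocycle p (b # r)"
    using c by (simp add: algebra_simps)
  then show ?thesis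
    using c by (simp add: cong_def mod_mult_left_eq)
qed auto

text \<open>A carry vanishes if two neighbours among its letters agree. This normalisation turns a
  nonzero value into differing consecutive labels.\<close>

lemma even_cocycle_degenerate:
  "even_cocycle p c \<noteq> 0 \<Longrightarrow> distinct_adj c"
  by (induction p c rule: even_cocycle.induct) (auto simp: carry_def)

lemma odd_cochain_degenerate:
  "odd_cochain p c \<noteq> 0 \<Longrightarrow> distinct_adj c"
  by (induction p c rule: odd_cochain.induct) (auto dest: even_cocycle_degenerate)

lemma carry_shift:
  "carry p ((a + 1) mod p) ((b + 1) mod p) ((c + 1) mod p) = carry p a b c"
  unfolding carry_def by (simp add: mod_diff_eq)

lemma even_cocycle_shift:
  "even_cocycle p (map (\<lambda>a. (a + 1) mod p) c) = even_cocycle p c"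
  by (induction p c rule: even_cocycle.induct) (auto simp: carry_shift)

lemma odd_cochain_shift:
  "odd_cochain p (map (\<lambda>a. (a + 1) mod p) c) = odd_cochain p c"
  using even_cocycle_shift[of p "tl c"]
  by (induction p c rule: odd_cochain.induct) (auto simp: mod_diff_eq)

section \<open>Equivariant labellings of chains\<close>

locale cyclic_cone_tower =
  fixes p :: nat and g :: "'a \<Rightarrow> 'a" and le :: "'a \<Rightarrow> 'a \<Rightarrow> bool"
    and X :: "nat \<Rightarrow> 'a set" and v :: "nat \<Rightarrow> 'a" and u :: "nat \<Rightarrow> 'a \<Rightarrow> 'a"
  assumes p_ge_2: "2 \<le> p"
    and g_mem: "x \<in> X q \<Longrightarrow> g x \<in> X q"
    and g_pow: "x \<in> X q \<Longrightarrow> (g ^^ p) x = x"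
    and g_mono: "le x y \<Longrightarrow> le (g x) (g y)"
    and X_Suc: "x \<in> X q \<Longrightarrow> x \<in> X (Suc q)"
    and v_mem: "v q \<in> X (Suc q)"
    and u_mem: "x \<in> X q \<Longrightarrow> u q x \<in> X (Suc q)"
    and le_u: "x \<in> X q \<Longrightarrow> le x (u q x)"
    and v_le_u: "x \<in> X q \<Longrightarrow> le (v q) (u q x)"
    and u_mono: "x \<in> X q \<Longrightarrow> y \<in> X q \<Longrightarrow> le x y \<Longrightarrow> le (u q x) (u q y)"
    and le_trans: "le x y \<Longrightarrow> le y z \<Longrightarrow> le x z"
begin

definition flag :: "nat \<Rightarrow> 'a list \<Rightarrow> bool" where
  "flag q c \<longleftrightarrow> length c = q \<and> set c \<subseteq> X q \<and> sorted_wrt le c"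

text \<open>The adjoint of multiplication by \<open>1\<close>, \<open>g - 1\<close> and \<open>1 + g + \<dots> + g\<^sup>p\<^sup>-\<^sup>1\<close>, alternating as in
  the periodic resolution of the cyclic group of order \<open>p\<close>.\<close>

definition twist :: "nat \<Rightarrow> ('a list \<Rightarrow> int) \<Rightarrow> 'a list \<Rightarrow> int" where
  "twist q \<phi> c = (if q = 0 then \<phi> c
     else if odd q then \<phi> (map g c) - \<phi> c
     else (\<Sum>j<p. \<phi> (map (g ^^ j) c)))"

text \<open>Evaluation of a cochain on the equivariant chain \<open>h\<^sub>q\<close> given by \<open>h\<^sub>0 = []\<close> and
  \<open>h\<^sub>q\<^sub>+\<^sub>1 = cone (\<tau>\<^sub>q h\<^sub>q)\<close>, where \<open>\<tau>\<^sub>q\<close> is the group ring element behind \<open>twist q\<close>.\<close>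

primrec chain_eval :: "nat \<Rightarrow> ('a list \<Rightarrow> int) \<Rightarrow> int" where
  "chain_eval 0 \<phi> = \<phi> []"
| "chain_eval (Suc q) \<phi> = chain_eval q (twist q (cone_cochain (v q) (u q) \<phi>))"

lemma twist_diff: "twist q (\<lambda>c. \<phi> c - \<psi> c) = (\<lambda>c. twist q \<phi> c - twist q \<psi> c)"
  by (auto simp: twist_def sum_subtractf)

lemma twist_scale: "twist q (\<lambda>c. x * \<phi> c) = (\<lambda>c. x * twist q \<phi> c)"
  by (auto simp: twist_def sum_distrib_left right_diff_distrib)

lemma coboundary_twist: "coboundary (twist q \<phi>) c = twist q (coboundary \<phi>) c"
proof -
  consider "q = 0" | "odd q" | "q \<noteq> 0" "even q" by auto
  then show ?thesis
  proof cases
    case 1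
    then show ?thesis by (simp add: twist_def[abs_def])
  next
    case 2
    then have "twist q \<psi> = (\<lambda>c. \<psi> (map g c) - \<psi> c)" for \<psi>
      by (auto simp: twist_def)
    then show ?thesis
      by (simp only: coboundary_diff coboundary_map)
  next
    case 3
    then have "twist q \<psi> = (\<lambda>c. \<Sum>j<p. \<psi> (map (g ^^ j) c))" for \<psi>
      by (auto simp: twist_def)
    then show ?thesis
      by (simp only: coboundary_sum coboundary_map)
  qed
qed

lemma chain_eval_diff:
  "chain_eval q (\<lambda>c. \<phi> c - \<psi> c) = chain_eval q \<phi> - chain_eval q \<psi>"
proof (induction q arbitrary: \<phi> \<psi>)
  case (Suc q)
  show ?case
    using Suc by (simp add: cone_diff twist_diff)
qed auto

lemma chain_eval_scale: "chain_eval q (\<lambda>c. x * \<phi> c) = x * chain_eval q \<phi>"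
proof (induction q arbitrary: \<phi>)
  case (Suc q)
  show ?case
    using Suc by (simp add: cone_scale twist_scale)
qed auto

lemma funpow_mem: "x \<in> X q \<Longrightarrow> (g ^^ j) x \<in> X q"
  by (induction j) (auto simp: g_mem)

lemma funpow_mono: "le x y \<Longrightarrow> le ((g ^^ j) x) ((g ^^ j) y)"
  by (induction j) (auto simp: g_mono)

lemma flag_map:
  assumes "flag q c"
  shows "flag q (map (g ^^ j) c)"
proof -
  have "sorted_wrt (\<lambda>x y. le ((g ^^ j) x) ((g ^^ j) y)) c"
    by (rule sorted_wrt_mono_rel[of c le]) (use assms funpow_mono in \<open>auto simp: flag_def\<close>)
  moreover have "(g ^^ j) ` set c \<subseteq> X q"
    using assms funpow_mem by (auto simp: flag_def)
  ultimately show ?thesis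
    using assms by (simp add: flag_def sorted_wrt_map)
qed

lemma flag_map1: "flag q c \<Longrightarrow> flag q (map g c)"
  using flag_map[of q c 1] by simp

lemma sorted_wrt_map_u:
  "set c \<subseteq> X q \<Longrightarrow> sorted_wrt le c \<Longrightarrow> sorted_wrt le (map (u q) c)"
  by (induction c) (auto intro: u_mono)

lemma flag_apex: "flag q c \<Longrightarrow> flag (Suc q) (v q # map (u q) c)"
  unfolding flag_def using sorted_wrt_map_u by (auto intro: v_mem u_mem v_le_u)

lemma flag_prism:
  assumes "flag q (xs @ y # ys)"
  shows "flag (Suc q) (xs @ y # map (u q) (y # ys))"
proof -
  have mem: "x \<in> X q" if "x \<in> set xs \<union> set (y # ys)" for x
    using assms that by (auto simp: flag_def)
  have xs: "sorted_wrt le xs" "sorted_wrt le (y # ys)"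
    using assms by (auto simp: flag_def sorted_wrt_append)
  have below: "le x z" if "x \<in> set xs" "z \<in> set (y # ys)" for x z
    using assms that by (auto simp: flag_def sorted_wrt_append)
  have "le x (u q z)" if "x \<in> insert y (set xs)" "z \<in> set (y # ys)" for x z
  proof (cases "x = z")
    case False
    then have "le x z"
      using that below xs(2) by auto
    then show ?thesis
      using le_trans le_u mem that(2) by blast
  qed (use le_u mem that in auto)
  moreover have "sorted_wrt le (map (u q) (y # ys))"
    using sorted_wrt_map_u[OF _ xs(2), of q] mem by blast
  moreover have "set (xs @ y # map (u q) (y # ys)) \<subseteq> X (Suc q)"
    using mem X_Suc u_mem by auto
  ultimately show ?thesis
    using assms xs(1) below by (auto simp: flag_def sorted_wrt_append)
qed

text \<open>Cones, prisms and powers of \<open>g\<close> turn flags into flags, so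
  \<open>h\<^sub>q\<close> is supported on flags of stage \<open>q\<close>. Identities that hold
  only on flags can thus be used under \<open>chain_eval\<close>.\<close>

lemma chain_eval_cong:
  assumes "\<And>c. flag q c \<Longrightarrow> \<phi> c = \<psi> c"
  shows "chain_eval q \<phi> = chain_eval q \<psi>"
  using assms
proof (induction q arbitrary: \<phi> \<psi>)
  case 0
  show ?case
    using "0.prems"[of "[]"] by (simp add: flag_def)
next
  case (Suc q)
  have "cone_cochain (v q) (u q) \<phi> c = cone_cochain (v q) (u q) \<psi> c" if "flag q c" for c
  proof -
    have "prism (u q) \<phi> c = prism (u q) \<psi> c"
      by (rule prism_cong, rule Suc.prems, rule flag_prism) (use that in simp)
    then show ?thesis
      by (simp add: cone_cochain_def Suc.prems flag_apex that)
  qed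
  then have "twist q (cone_cochain (v q) (u q) \<phi>) c = twist q (cone_cochain (v q) (u q) \<psi>) c"
    if "flag q c" for c
    using that by (cases "q = 0") (simp_all add: twist_def flag_map flag_map1)
  then show ?case
    unfolding chain_eval.simps by (rule Suc.IH)
qed

text \<open>On flags the difference is \<open>m\<close> times an integral cochain, and evaluation is
  linear.\<close>

lemma chain_eval_cong_mod:
  assumes "\<And>c. flag q c \<Longrightarrow> [\<phi> c = \<psi> c] (mod m)"
  shows "[chain_eval q \<phi> = chain_eval q \<psi>] (mod m)"
proof -
  have "chain_eval q (\<lambda>c. \<phi> c - \<psi> c) = chain_eval q (\<lambda>c. m * ((\<phi> c - \<psi> c) div m))"
    using assms by (intro chain_eval_cong) (simp add: cong_iff_dvd_diff)
  then have "chain_eval q \<phi> - chain_eval q \<psi> = m * chain_eval q (\<lambda>c. (\<phi> c - \<psi> c) div m)"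
    by (simp add: chain_eval_diff chain_eval_scale)
  then show ?thesis
    by (simp add: cong_iff_dvd_diff)
qed

text \<open>The product of \<open>g - 1\<close> and the norm element is \<open>g ^^ p - 1\<close>,
  which acts as 0. For \<open>q = 0\<close> the flag is the empty word, which \<open>g\<close>
  fixes.\<close>

lemma twist_twist:
  assumes "flag q c"
  shows "twist q (twist (Suc q) \<phi>) c = 0"
proof -
  have *: "map (g ^^ p) c = c"
    using assms g_pow by (auto simp: flag_def intro: map_idI)
  have **: "(\<Sum>j<p. \<phi> (map (g ^^ Suc j) c)) = (\<Sum>j<p. \<phi> (map (g ^^ j) c))"
    using sum.lessThan_Suc_shift[of "\<lambda>j. \<phi> (map (g ^^ j) c)" p] 
      sum.lessThan_Suc[of "\<lambda>j. \<phi> (map (g ^^ j) c)" p] *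
    by (simp add: comp_def)
  consider "q = 0" | "odd q" | "q \<noteq> 0" "even q" by auto
  then show ?thesis
  proof cases
    case 1
    then show ?thesis using assms by (simp add: twist_def flag_def)
  next
    case 2
    then show ?thesis using ** by (auto simp: twist_def comp_def funpow_swap1)
  next
    case 3
    then show ?thesis using ** by (auto simp: twist_def sum_subtractf comp_def)
  qed
qed

text \<open>Dually, the boundary of \<open>h\<^sub>q\<^sub>+\<^sub>1\<close> is
  \<open>\<tau>\<^sub>q h\<^sub>q\<close>: the boundary of a cone is its base minus the cone over
  the boundary of the base, and this base is a cycle because consecutive \<open>\<tau>\<close>
  multiply to 0.\<close>

lemma chain_eval_coboundary:
  "chain_eval (Suc q) (coboundary \<phi>) = chain_eval q (twist q \<phi>)"
proof (induction q arbitrary: \<phi>)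
  case 0
  show ?case
    by (simp add: twist_def cone_cochain_def)
next
  case (Suc q)
  let ?\<psi> = "cone_cochain (v (Suc q)) (u (Suc q)) \<phi>"
  have "chain_eval (Suc q) (coboundary (twist (Suc q) ?\<psi>))
      = chain_eval q (twist q (twist (Suc q) ?\<psi>))"
    by (rule Suc)
  \<comment> \<open>The zero cochain is written as a multiple so that
    \<open>chain_eval_scale\<close> evaluates it.\<close>
  also have "\<dots> = chain_eval q (\<lambda>c. 0 * 0)"
    by (rule chain_eval_cong) (simp add: twist_twist)
  also have "\<dots> = 0"
    by (subst chain_eval_scale) simp
  finally have "chain_eval (Suc q) (coboundary (twist (Suc q) ?\<psi>)) = 0" .
  moreover have "chain_eval (Suc (Suc q)) (coboundary \<phi>)
      = chain_eval (Suc q) (twist (Suc q) (\<lambda>c. \<phi> c - coboundary ?\<psi> c))"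
    unfolding chain_eval.simps(2)[of "Suc q"] cone_coboundary ..
  moreover have "twist (Suc q) (\<lambda>c. \<phi> c - coboundary ?\<psi> c)
      = (\<lambda>c. twist (Suc q) \<phi> c - coboundary (twist (Suc q) ?\<psi>) c)"
    unfolding twist_diff using coboundary_twist[of "Suc q"] by auto
  ultimately show ?case
    by (simp only: chain_eval_diff)
qed

lemma X_mono: "q \<le> n \<Longrightarrow> X q \<subseteq> X n"
  by (induction rule: dec_induct) (auto dest: X_Suc)

text \<open>Pulled back along \<open>s\<close>, the generator takes the value 1 modulo
  \<open>p\<close> on \<open>h\<^sub>n\<close>. Hence it is nonzero on some flag, and normalisation
  makes the neighbouring labels there differ.\<close>

lemma ex_flag_distinct_adj:
  fixes s :: "'a \<Rightarrow> int"
  assumes s: "\<And>x. x \<in> X n \<Longrightarrow> s (g x) = (s x + 1) mod int p"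
  shows "\<exists>c. flag n c \<and> distinct_adj (map s c)"
proof (cases n)
  case 0
  then show ?thesis by (auto simp: flag_def)
next
  case (Suc m)
  define P where "P = int p"
  have P: "P > 0"
    using p_ge_2 by (simp add: P_def)
  \<comment> \<open>Words of length \<open>q\<close> have degree \<open>q - 1\<close>, so odd
    \<open>q\<close> takes the even cocycle.\<close>
  define W where "W q = (if odd q then even_cocycle P else odd_cochain P)" for q :: nat
  have map_s: "map s (map g c) = map (\<lambda>a. (a + 1) mod P) (map s c)"
    if "flag q c" "q \<le> n" for q c
    using that s X_mono[of q n] by (auto simp: flag_def P_def)
  have W_shift: "W q' (map s (map g c)) = W q' (map s c)" if "flag q c" "q \<le> n" for q q' c
    unfolding map_s[OF that] W_def
    by (simp add: even_cocycle_shift odd_cochain_shift del: map_map list.map_comp)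
  have W_pow: "W q' (map s (map (g ^^ j) c)) = W q' (map s c)" 
    if "flag q c" "q \<le> n" for q q' c j
  proof (induction j)
    case (Suc j)
    have "W q' (map s (map (g ^^ Suc j) c)) = W q' (map s (map g (map (g ^^ j) c)))"
      by simp
    also have "\<dots> = W q' (map s c)"
      using W_shift[OF flag_map[OF that(1)] that(2)] Suc by simp
    finally show ?case .
  qed simp
  have "[chain_eval (Suc q) (\<lambda>c. W (Suc q) (map s c)) = 1] (mod P)" if "Suc q \<le> n" for q
    using that
  proof (induction q)
    case 0
    then show ?case by (simp add: twist_def cone_cochain_def W_def)
  next
    case (Suc q)
    note IH = Suc.IH[OF Suc_leD[OF Suc.prems]] and q = Suc_leD[OF Suc.prems]
    show ?case
    proof (cases "odd (Suc q)")
      case True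
      \<comment> \<open>Modulo \<open>p\<close> the odd cochain is the coboundary of
        \<open>\<phi>\<close>, so evaluation descends one degree. There the twist is
        \<open>g - 1\<close>, which replaces the factor \<open>hd\<close> by 1 modulo
        \<open>p\<close>.\<close>
      define \<phi> where "\<phi> d = hd d * even_cocycle P d" for d
      have "[chain_eval (Suc (Suc q)) (\<lambda>c. W (Suc (Suc q)) (map s c))
          = chain_eval (Suc (Suc q)) (coboundary (\<lambda>c. \<phi> (map s c)))] (mod P)"
      proof (rule chain_eval_cong_mod)
        fix c assume "flag (Suc (Suc q)) c"
        then have "[coboundary \<phi> (map s c) = odd_cochain P (map s c)] (mod P)"
          unfolding \<phi>_def by (intro coboundary_hd_even_cocycle P) (use True in \<open>auto simp: flag_def\<close>)
        then show "[W (Suc (Suc q)) (map s c) = coboundary (\<lambda>c. \<phi> (map s c)) c] (mod P)"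
          using True by (simp add: W_def coboundary_map cong_sym)
      qed
      also have "chain_eval (Suc (Suc q)) (coboundary (\<lambda>c. \<phi> (map s c)))
          = chain_eval (Suc q) (twist (Suc q) (\<lambda>c. \<phi> (map s c)))"
        by (rule chain_eval_coboundary)
      also have "[\<dots> = chain_eval (Suc q) (\<lambda>c. W (Suc q) (map s c))] (mod P)"
      proof (rule chain_eval_cong_mod)
        fix c assume c: "flag (Suc q) c"
        then obtain a d where ad: "map s c = a # d"
          by (cases c) (auto simp: flag_def)
        have "W (Suc q) (map s (map g c)) = W (Suc q) (map s c)"
          using W_shift c q .
        then have "twist (Suc q) (\<lambda>c. \<phi> (map s c)) c
            = ((a + 1) mod P - a) * W (Suc q) (map s c)"
          using True c ad map_s[OF c q] by (simp add: twist_def \<phi>_def W_def algebra_simps)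
        moreover have "[(a + 1) mod P - a = 1] (mod P)"
          by (simp add: cong_def mod_diff_left_eq)
        ultimately show "[twist (Suc q) (\<lambda>c. \<phi> (map s c)) c = W (Suc q) (map s c)] (mod P)"
          using cong_mult[OF _ cong_refl, of "(a + 1) mod P - a" 1 P "W (Suc q) (map s c)"] by simp
      qed
      also note IH
      finally show ?thesis .
    next
      case False
      \<comment> \<open>Here the twist is the norm, which multiplies an invariant cochain by
        \<open>P\<close>, while the coboundary of the odd cochain is \<open>P\<close> times the even
        one. The equations are exact, so \<open>P\<close> can be cancelled.\<close>
      let ?\<phi> = "\<lambda>c. W (Suc q) (map s c)"
      have "P * chain_eval (Suc (Suc q)) (\<lambda>c. W (Suc (Suc q)) (map s c))
          = chain_eval (Suc (Suc q)) (coboundary ?\<phi>)"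
        unfolding chain_eval_scale[symmetric]
      proof (rule chain_eval_cong)
        fix c assume "flag (Suc (Suc q)) c"
        then have "coboundary (odd_cochain P) (map s c) = P * even_cocycle P (map s c)"
          using False by (intro coboundary_odd_cochain P) (auto simp: flag_def)
        then show "P * W (Suc (Suc q)) (map s c) = coboundary ?\<phi> c"
          using False by (simp add: W_def coboundary_map)
      qed
      also have "\<dots> = chain_eval (Suc q) (twist (Suc q) ?\<phi>)"
        by (rule chain_eval_coboundary)
      also have "\<dots> = chain_eval (Suc q) (\<lambda>c. P * ?\<phi> c)"
      proof (rule chain_eval_cong)
        fix c assume "flag (Suc q) c"
        then show "twist (Suc q) ?\<phi> c = P * ?\<phi> c"
          using False by (simp only: twist_def W_pow[OF _ q]) (simp add: P_def)
      qed
      also have "\<dots> = P * chain_eval (Suc q) ?\<phi>"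
        by (rule chain_eval_scale)
      finally show ?thesis
        using IH P by simp
    qed
  qed
  then have "[chain_eval n (\<lambda>c. W n (map s c)) = 1] (mod P)"
    using Suc by simp
  moreover have "\<not> [0 = 1] (mod P)"
    using p_ge_2 by (simp add: P_def cong_def)
  moreover have "chain_eval n (\<lambda>c. 0 * 0) = 0"
    by (subst chain_eval_scale) simp
  ultimately obtain c where "flag n c" "W n (map s c) \<noteq> 0"
    using chain_eval_cong[of n "\<lambda>c. W n (map s c)" "\<lambda>c. 0 * 0"] by force
  then show ?thesis
    by (auto simp: W_def split: if_splits intro: even_cocycle_degenerate odd_cochain_degenerate)
qed

end

section \<open>The Alon--Frankl--Lovasz theorem\<close>

definition rotate_map :: "nat \<Rightarrow> (nat \<rightharpoonup> nat) \<Rightarrow> (nat \<rightharpoonup> nat)" where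
  "rotate_map p A = (\<lambda>x. map_option (\<lambda>i. Suc i mod p) (A x))"

text \<open>Nonzero vectors with coordinates below \<open>q\<close>: \<open>None\<close> stands for
  the zero entry, \<open>Some i\<close> for the residue \<open>i\<close>, and extension is
  \<open>\<subseteq>\<^sub>m\<close>.\<close>

definition signed_sets :: "nat \<Rightarrow> nat \<Rightarrow> (nat \<rightharpoonup> nat) set" where
  "signed_sets p q = {A. A \<noteq> Map.empty \<and> dom A \<subseteq> {..<q} \<and> ran A \<subseteq> {..<p}}"

lemma dom_rotate_map [simp]: "dom (rotate_map p A) = dom A"
  by (auto simp: rotate_map_def)

lemma rotate_map_mem:
  assumes "p > 0" "A \<in> signed_sets p q"
  shows "rotate_map p A \<in> signed_sets p q"
proof -
  have "dom (rotate_map p A) \<noteq> {}"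
    using assms(2) by (simp add: signed_sets_def)
  then have "rotate_map p A \<noteq> Map.empty"
    by (metis dom_empty)
  moreover have "ran (rotate_map p A) \<subseteq> {..<p}"
    using assms(1) by (auto simp: rotate_map_def ran_def)
  ultimately show ?thesis
    using assms(2) by (simp add: signed_sets_def)
qed

lemma funpow_rotate_map:
  assumes "p > 0" "A \<in> signed_sets p q"
  shows "(rotate_map p ^^ j) A = (\<lambda>x. map_option (\<lambda>i. (i + j) mod p) (A x))"
proof (induction j)
  case 0
  have "map_option (\<lambda>i. i mod p) (A x) = A x" for x
    using assms by (cases "A x") (auto simp: signed_sets_def ran_def)
  then show ?case by simp
next
  case (Suc j)
  then show ?case
    by (simp add: rotate_map_def option.map_comp comp_def mod_Suc_eq)
qed

text \<open>Coordinate \<open>q\<close> is free on stage \<open>q\<close>. Setting it to the residue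
  0 extends \<open>A\<close> and also the vector supported at \<open>q\<close> alone.\<close>

lemma cyclic_cone_tower_signed_sets:
  assumes "p \<ge> 2"
  shows "cyclic_cone_tower p (rotate_map p) (\<subseteq>\<^sub>m) (signed_sets p)
    (\<lambda>q. [q \<mapsto> 0]) (\<lambda>q A. A(q \<mapsto> 0))"
proof
  fix A q assume A: "A \<in> signed_sets p q"
  show "rotate_map p A \<in> signed_sets p q"
    using A assms by (intro rotate_map_mem) auto
  have "map_option (\<lambda>i. i mod p) (A x) = A x" for x
    using A by (cases "A x") (auto simp: signed_sets_def ran_def)
  then show "(rotate_map p ^^ p) A = A"
    using A assms by (subst funpow_rotate_map) auto
  show "A \<in> signed_sets p (Suc q)"
    using A by (auto simp: signed_sets_def less_Suc_eq_le)
  show "A(q \<mapsto> 0) \<in> signed_sets p (Suc q)"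
    using A assms by (auto simp: signed_sets_def less_Suc_eq_le ran_def split: if_splits)
  show "A \<subseteq>\<^sub>m A(q \<mapsto> 0)" "[q \<mapsto> 0] \<subseteq>\<^sub>m A(q \<mapsto> 0)"
    using A by (auto simp: signed_sets_def map_le_def)
next
  fix A B :: "nat \<rightharpoonup> nat" and q
  assume "A \<subseteq>\<^sub>m B"
  then show "rotate_map p A \<subseteq>\<^sub>m rotate_map p B" "A(q \<mapsto> 0) \<subseteq>\<^sub>m B(q \<mapsto> 0)"
    by (force simp: map_le_def rotate_map_def)+
next
  fix q show "[q \<mapsto> 0] \<in> signed_sets p (Suc q)"
    using assms by (auto simp: signed_sets_def)
next
  show "A \<subseteq>\<^sub>m C" if "A \<subseteq>\<^sub>m B" "B \<subseteq>\<^sub>m C" for A B C :: "nat \<rightharpoonup> nat"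
    using that by (rule map_le_trans)
qed (use assms in simp)

lemma bij_betw_Suc_mod:
  assumes "p > 0"
  shows "bij_betw (\<lambda>i. Suc i mod p) {..<p} {..<p}"
proof -
  have "inj_on (\<lambda>i. Suc i mod p) {..<p}"
    by (auto simp: inj_on_def mod_Suc split: if_splits)
  moreover have "(\<lambda>i. Suc i mod p) ` {..<p} \<subseteq> {..<p}"
    using assms by auto
  ultimately show ?thesis
    by (simp add: bij_betw_def endo_inj_surj)
qed

section \<open>Disjoint sets of one colour\<close>

definition has_disjoint_monochromatic :: "nat \<Rightarrow> nat \<Rightarrow> nat set \<Rightarrow> (nat set \<Rightarrow> nat) \<Rightarrow> bool" where
  "has_disjoint_monochromatic r K V col \<longleftrightarrow>
     (\<exists>F c. (\<forall>j<r. F j \<subseteq> V \<and> card (F j) = K \<and> col (F j) = c) \<and> disjoint_family_on F {..<r})"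

text \<open>Ranks lie between 1 and \<open>p * (K - 1) + m * (p - 1)\<close>, which is less than
  \<open>n\<close> by the last hypothesis, yet they would increase strictly along a chain of length
  \<open>n\<close>.\<close>

lemma prime_disjoint_monochromatic_lessThan:
  assumes p: "prime p" and K: "K \<ge> 1"
    and col: "\<And>F. F \<subseteq> {..<n} \<Longrightarrow> card F = K \<Longrightarrow> col F < m"
    and n: "p * m + p * K + 1 \<le> n + m + p"
  shows "has_disjoint_monochromatic p K {..<n} col"
proof (rule ccontr)
  assume contra: "\<not> ?thesis"
  have p2: "p \<ge> 2" and p0: "p > 0"
    using p prime_ge_2_nat prime_gt_0_nat by auto
  interpret cyclic_cone_tower p "rotate_map p" "(\<subseteq>\<^sub>m)" "signed_sets p"
    "\<lambda>q. [q \<mapsto> 0]" "\<lambda>q A. A(q \<mapsto> 0)"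
    by (rule cyclic_cone_tower_signed_sets[OF p2])
  define cls where "cls A i = {x. A x = Some i}" for A :: "nat \<rightharpoonup> nat" and i
  \<comment> \<open>The residues whose class contains a \<open>K\<close>-set of colour
    \<open>c\<close>. They are never all of \<open>{..<p}\<close>, since distinct classes are
    disjoint.\<close>
  define B where "B A c = {i\<in>{..<p}. \<exists>F\<subseteq>cls A i. card F = K \<and> col F = c}" for A c
  define big where "big A \<longleftrightarrow> (\<exists>c<m. B A c \<noteq> {})" for A
  define c0 where "c0 A = (LEAST c. c < m \<and> B A c \<noteq> {})" for A
  \<comment> \<open>Inverses modulo \<open>p\<close> of the possible sizes of a proper nonempty
    subset; this uses that \<open>p\<close> is prime.\<close>
  obtain y :: "nat \<Rightarrow> nat" where y: "[b * y b = 1] (mod p)" if "0 < b" "b < p" for b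
  proof -
    have "\<exists>x. [b * x = 1] (mod p)" if "0 < b" "b < p" for b
      using cong_solve_coprime_nat[of b p] that p
      by (metis One_nat_def coprime_commute nat_dvd_not_less prime_imp_coprime)
    then show ?thesis using that by metis
  qed
  \<comment> \<open>Shifting \<open>S\<close> by \<open>1\<close> adds \<open>card S\<close> to its sum, so \<open>w\<close> is an equivariant label for the proper
    nonempty subsets of \<open>\<int>\<^sub>p\<close>.\<close>
  define w where "w S = y (card S) * \<Sum>S mod p" for S
  \<comment> \<open>A big \<open>A\<close> is labelled through its least occurring colour, which
    rotation preserves, any other \<open>A\<close> by its entry at the least coordinate.\<close>
  define s where "s A = int (if big A then w (B A (c0 A)) else the (A (Min (dom A))))" for A
  \<comment> \<open>The offset puts every big vector above all others, whose classes have at most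
    \<open>K - 1\<close> elements each.\<close>
  define rk where
    "rk A = (if big A then p * (K - 1) + (\<Sum>c<m. card (B A c)) else card (dom A))" for A
  have finB [simp]: "finite (B A c)" for A c
    by (simp add: B_def)
  have cls_dom: "cls A i \<subseteq> dom A" for A i
    by (auto simp: cls_def)
  have fin_dom: "finite (dom A)" "dom A \<subseteq> {..<n}" if "A \<in> signed_sets p n" for A
    using that finite_subset by (auto simp: signed_sets_def)
  have B_proper: "card (B A c) < p" if "A \<in> signed_sets p n" for A c
  proof (rule ccontr)
    assume "\<not> ?thesis"
    then have "B A c = {..<p}"
      by (intro card_seteq) (auto simp: B_def)
    then have "\<forall>i\<in>{..<p}. \<exists>F\<subseteq>cls A i. card F = K \<and> col F = c"
      by (auto simp: B_def)
    then obtain F where F: "\<And>i. i < p \<Longrightarrow> F i \<subseteq> cls A i \<and> card (F i) = K \<and> col (F i) = c"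
      by (metis lessThan_iff)
    have "disjoint_family_on F {..<p}"
      unfolding disjoint_family_on_def
    proof (intro ballI impI)
      fix i j assume "i \<in> {..<p}" "j \<in> {..<p}" "i \<noteq> j"
      then have "F i \<subseteq> cls A i" "F j \<subseteq> cls A j" "cls A i \<inter> cls A j = {}"
        using F by (auto simp: cls_def)
      then show "F i \<inter> F j = {}"
        by blast
    qed
    moreover have "F i \<subseteq> {..<n}" if "i < p" for i
      using F[OF that] cls_dom[of A i] fin_dom(2)[OF \<open>A \<in> _\<close>] by blast
    ultimately show False
      using contra F unfolding has_disjoint_monochromatic_def by blast
  qed
  have small: "card (dom A) \<le> p * (K - 1)" if A: "A \<in> signed_sets p n" and "\<not> big A" for A
  proof -
    have cls_le: "card (cls A i) \<le> K - 1" if "i < p" for i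
    proof (rule ccontr)
      assume "\<not> ?thesis"
      then have "K \<le> card (cls A i)"
        by linarith
      then obtain F where F: "F \<subseteq> cls A i" "card F = K"
        by (rule obtain_subset_with_card_n)
      have "F \<subseteq> {..<n}"
        using F(1) cls_dom[of A i] fin_dom(2)[OF A] by blast
      then have "col F < m"
        using col F(2) by blast
      moreover have "i \<in> B A (col F)"
        unfolding B_def using F \<open>i < p\<close> by blast
      ultimately show False
        using \<open>\<not> big A\<close> unfolding big_def by blast
    qed
    have "dom A = (\<Union>i<p. cls A i)"
      using A by (auto simp: cls_def signed_sets_def ran_def)
    then have "card (dom A) \<le> (\<Sum>i<p. card (cls A i))"
      by (simp add: card_UN_le)
    also have "\<dots> \<le> (\<Sum>i<p. K - 1)"
      by (intro sum_mono) (use cls_le in simp)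
    finally show ?thesis
      by simp
  qed
  have c0: "c0 A < m" "B A (c0 A) \<noteq> {}" if "big A" for A
    using that LeastI_ex[of "\<lambda>c. c < m \<and> B A c \<noteq> {}"] by (auto simp: big_def c0_def)
  have big_rk: "p * (K - 1) < rk A" if "big A" for A
  proof -
    have "0 < card (B A (c0 A))"
      using c0[OF that] by (simp add: card_gt_0_iff)
    also have "\<dots> \<le> (\<Sum>c<m. card (B A c))"
      using c0[OF that] by (intro member_le_sum) auto
    finally show ?thesis
      using that by (simp add: rk_def)
  qed
  have rk_pos: "rk A > 0" if "A \<in> signed_sets p n" for A
  proof (cases "big A")
    case False
    then show ?thesis
      using that fin_dom(1)[OF that] by (auto simp: rk_def signed_sets_def card_gt_0_iff)
  qed (use big_rk in force)
  have rk_le: "rk A \<le> p * (K - 1) + m * (p - 1)" if "A \<in> signed_sets p n" for A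
  proof (cases "big A")
    case True
    have "card (B A c) \<le> p - 1" for c
      using B_proper[OF that, of c] by linarith
    then have "(\<Sum>c<m. card (B A c)) \<le> (\<Sum>c<m. p - 1)"
      by (intro sum_mono)
    then show ?thesis
      using True by (simp add: rk_def)
  qed (use small[OF that] in \<open>simp add: rk_def\<close>)
  have rk_less: "rk A < rk A'"
    if A: "A \<in> signed_sets p n" "A' \<in> signed_sets p n"
      and le: "A \<subseteq>\<^sub>m A'" and neq: "s A \<noteq> s A'" for A A'
  proof -
    have cls_mono: "cls A i \<subseteq> cls A' i" for i
      using le by (force simp: cls_def map_le_def)
    have B_mono: "B A c \<subseteq> B A' c" for c
      unfolding B_def using subset_trans[OF _ cls_mono] by blast
    consider "big A" "big A'" | "\<not> big A" "big A'" | "\<not> big A" "\<not> big A'"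
      using B_mono unfolding big_def by blast
    then show ?thesis
    proof cases
      case 1
      \<comment> \<open>The label depends only on the sets \<open>B A c\<close>, so a change of
        label forces one of them to grow.\<close>
      have "\<exists>c<m. B A c \<noteq> B A' c"
      proof (rule ccontr)
        assume *: "\<not> ?thesis"
        then have "(\<lambda>c. c < m \<and> B A c \<noteq> {}) = (\<lambda>c. c < m \<and> B A' c \<noteq> {})"
          by auto
        then have "c0 A = c0 A'"
          by (simp add: c0_def)
        then show False
          using neq * c0[OF 1(1)] 1 by (simp add: s_def)
      qed
      then have "\<exists>c\<in>{..<m}. card (B A c) < card (B A' c)"
        using B_mono psubset_card_mono[OF finB] by (metis lessThan_iff psubsetI)
      then have "(\<Sum>c<m. card (B A c)) < (\<Sum>c<m. card (B A' c))"
        by (intro sum_strict_mono_ex1) (use card_mono[OF finB B_mono] in auto)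
      then show ?thesis
        using 1 by (simp add: rk_def)
    next
      case 2
      then show ?thesis
        using small[OF A(1)] big_rk[of A'] by (simp add: rk_def)
    next
      case 3
      have "dom A \<noteq> dom A'"
      proof
        assume "dom A = dom A'"
        then have "A' \<subseteq>\<^sub>m A"
          using le by (simp add: map_le_def)
        then have "A = A'"
          using le map_le_antisym by blast
        then show False using neq by simp
      qed
      then have "dom A \<subset> dom A'"
        using le map_le_implies_dom_le by blast
      then show ?thesis
        using 3 fin_dom(1)[OF A(2)] by (simp add: rk_def psubset_card_mono)
    qed
  qed
  have equivariant: "s (rotate_map p A) = (s A + 1) mod int p" if A: "A \<in> signed_sets p n" for A
  proof -
    let ?\<sigma> = "\<lambda>i. Suc i mod p" and ?A = "rotate_map p A"
    have bij: "bij_betw ?\<sigma> {..<p} {..<p}"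
      by (rule bij_betw_Suc_mod[OF p0])
    have cls_rot: "cls ?A (?\<sigma> i) = cls A i" if "i < p" for i
    proof (rule set_eqI)
      fix x
      show "x \<in> cls ?A (?\<sigma> i) \<longleftrightarrow> x \<in> cls A i"
      proof (cases "A x")
        case (Some j)
        then have "j \<in> {..<p}"
          using A ranI[of A x j] unfolding signed_sets_def by blast
        then have "?\<sigma> j = ?\<sigma> i \<longleftrightarrow> j = i"
          using inj_on_eq_iff[OF bij_betw_imp_inj_on[OF bij], of j i] that by simp
        then show ?thesis
          using Some by (simp add: cls_def rotate_map_def)
      qed (simp add: cls_def rotate_map_def)
    qed
    have B_rot: "B ?A c = ?\<sigma> ` B A c" for c
    proof -
      have "B ?A c = {i \<in> ?\<sigma> ` {..<p}. \<exists>F\<subseteq>cls ?A i. card F = K \<and> col F = c}"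
        using bij by (simp add: B_def bij_betw_def)
      also have "\<dots> = ?\<sigma> ` {i \<in> {..<p}. \<exists>F\<subseteq>cls ?A (?\<sigma> i). card F = K \<and> col F = c}"
        by auto
      also have "\<dots> = ?\<sigma> ` B A c"
        unfolding B_def
        by (intro arg_cong[where f = "(`) ?\<sigma>"] Collect_cong) (use cls_rot in auto)
      finally show ?thesis .
    qed
    have big_rot: "big ?A = big A" and c0_rot: "c0 ?A = c0 A"
      by (simp_all add: big_def c0_def B_rot)
    show ?thesis
    proof (cases "big A")
      case True
      define S where "S = B A (c0 A)"
      have S: "S \<subseteq> {..<p}" "finite S" "0 < card S" "card S < p"
        using c0[OF True] B_proper[OF A] by (auto simp: S_def B_def card_gt_0_iff)
      have inj: "inj_on ?\<sigma> S"
        using bij S(1) inj_on_subset by (auto simp: bij_betw_def)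
      have "[\<Sum>(?\<sigma> ` S) = (\<Sum>i\<in>S. Suc i)] (mod p)"
        unfolding sum.reindex[OF inj] by (simp add: cong_def mod_sum_eq)
      also have "(\<Sum>i\<in>S. Suc i) = \<Sum>S + card S"
        by (simp add: sum_Suc)
      finally have "[y (card S) * \<Sum>(?\<sigma> ` S) = y (card S) * (\<Sum>S + card S)] (mod p)"
        by (rule cong_scalar_left)
      also have "y (card S) * (\<Sum>S + card S) = y (card S) * \<Sum>S + card S * y (card S)"
        by (simp add: algebra_simps)
      also have "[\<dots> = y (card S) * \<Sum>S + 1] (mod p)"
        using y[OF S(3,4)] by (intro cong_add) auto
      finally have "w (?\<sigma> ` S) = (w S + 1) mod p"
        by (simp add: w_def card_image[OF inj] cong_def mod_Suc_eq)
      then show ?thesis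
        using True by (simp add: s_def big_rot c0_rot B_rot S_def of_nat_mod add.commute)
    next
      case False
      have "Min (dom A) \<in> dom A"
        using A fin_dom[OF A] by (intro Min_in) (auto simp: signed_sets_def)
      then obtain i where "A (Min (dom A)) = Some i"
        by blast
      moreover from this have "?A (Min (dom A)) = Some (?\<sigma> i)"
        by (simp add: rotate_map_def)
      ultimately show ?thesis
        using False by (simp add: s_def big_rot of_nat_mod add.commute)
    qed
  qed
  obtain C where C: "flag n C" "distinct_adj (map s C)"
    using ex_flag_distinct_adj[of n s] equivariant by blast
  have mem: "C ! j \<in> signed_sets p n" if "j < n" for j
    using C(1) that by (auto simp: flag_def)
  \<comment> \<open>Ranks start at 1 or more and grow at each step, so the last of the
    \<open>n\<close> ranks is at least \<open>n\<close>.\<close>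
  have "j < rk (C ! j)" if "j < n" for j
    using that
  proof (induction j)
    case 0
    then show ?case using rk_pos mem by simp
  next
    case (Suc j)
    have "C ! j \<subseteq>\<^sub>m C ! Suc j"
      using C(1) Suc.prems by (auto simp: flag_def sorted_wrt_iff_nth_less)
    moreover have "s (C ! j) \<noteq> s (C ! Suc j)"
      using C Suc.prems distinct_adj_nth[OF C(2), of j] by (simp add: flag_def)
    ultimately show ?case
      using rk_less[of "C ! j" "C ! Suc j"] mem Suc by force
  qed
  moreover have "n > 0"
    using n p0 K by (cases p; cases K) auto
  ultimately have "n - 1 < rk (C ! (n - 1))"
    by simp
  also have "\<dots> \<le> p * (K - 1) + m * (p - 1)"
    using rk_le mem \<open>n > 0\<close> by simp
  finally show False
    using n p0 K by (cases p; cases K) (auto simp: algebra_simps)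
qed

lemma prime_disjoint_monochromatic:
  assumes p: "prime p" and K: "K \<ge> 1" and V: "finite V"
    and col: "\<And>F. F \<subseteq> V \<Longrightarrow> card F = K \<Longrightarrow> col F < m"
    and le: "p * m + p * K + 1 \<le> card V + m + p"
  shows "has_disjoint_monochromatic p K V col"
proof -
  obtain h where h: "bij_betw h {..<card V} V"
    using ex_bij_betw_nat_finite[OF V] by (auto simp: atLeast0LessThan)
  have inj: "inj_on h {..<card V}" and im: "h ` {..<card V} = V"
    using h by (auto simp: bij_betw_def)
  have "has_disjoint_monochromatic p K {..<card V} (\<lambda>F. col (h ` F))"
  proof (rule prime_disjoint_monochromatic_lessThan[OF p K _ le])
    fix F assume F: "F \<subseteq> {..<card V}" "card F = K"
    then have "card (h ` F) = K"
      using card_image[OF inj_on_subset[OF inj]] by simp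
    moreover have "h ` F \<subseteq> V"
      using F(1) im by blast
    ultimately show "col (h ` F) < m"
      by (intro col)
  qed
  then obtain F c where F: "\<And>j. j < p \<Longrightarrow> F j \<subseteq> {..<card V} \<and> card (F j) = K \<and> col (h ` F j) = c"
    "disjoint_family_on F {..<p}"
    unfolding has_disjoint_monochromatic_def by blast
  have "h ` F j \<subseteq> V \<and> card (h ` F j) = K \<and> col (h ` F j) = c" if "j < p" for j
    using F(1)[OF that] im card_image[OF inj_on_subset[OF inj, of "F j"]] by auto
  moreover have "disjoint_family_on (\<lambda>j. h ` F j) {..<p}"
    unfolding disjoint_family_on_def
  proof (intro ballI impI)
    fix i j assume ij: "i \<in> {..<p}" "j \<in> {..<p}" "i \<noteq> j"
    then have "h ` F i \<inter> h ` F j = h ` (F i \<inter> F j)"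
      using F(1)[of i] F(1)[of j] by (intro inj_on_image_Int[OF inj, symmetric]) auto
    then show "h ` F i \<inter> h ` F j = {}"
      using F(2) ij by (simp add: disjoint_family_on_def)
  qed
  ultimately show ?thesis
    unfolding has_disjoint_monochromatic_def by (intro exI[of _ "\<lambda>j. h ` F j"]) blast
qed

text \<open>The hypothesis is \<open>card V \<ge> (r - 1) * m + r * (K - 1) + 1\<close> without subtraction. A composite \<open>a * b\<close> is handled by colouring each set of
  size \<open>a * m + a * K + 1 - m - a\<close> with a colour of \<open>a\<close> disjoint \<open>K\<close>-subsets of it.\<close>

theorem disjoint_monochromatic:
  assumes "K \<ge> 1" "finite V"
    and "\<And>F. F \<subseteq> V \<Longrightarrow> card F = K \<Longrightarrow> col F < m"
    and "r * m + r * K + 1 \<le> card V + m + r"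
  shows "has_disjoint_monochromatic r K V col"
  using assms
proof (induction r arbitrary: K V col rule: prime_divisors_induct)
  case zero
  then show ?case
    by (simp add: has_disjoint_monochromatic_def disjoint_family_on_def)
next
  case (unit r)
  then have r: "r = 1" by simp
  then have "K \<le> card V"
    using unit.prems by simp
  then obtain F where "F \<subseteq> V" "card F = K"
    by (rule obtain_subset_with_card_n)
  then show ?case
    unfolding has_disjoint_monochromatic_def r
    by (intro exI[of _ "\<lambda>_. F"]) (auto simp: disjoint_family_on_def)
next
  case (factor a b)
  have a: "a \<ge> 1"
    using factor.hyps(1) prime_ge_1_nat by simp
  show ?case
  proof (cases "b = 0")
    case True
    then show ?thesis
      by (simp add: has_disjoint_monochromatic_def disjoint_family_on_def)
  next
    case False
    define K' where "K' = a * m + a * K + 1 - m - a"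
    have "m \<le> a * m" "a \<le> a * K"
      using a factor.prems(1) by simp_all
    then have K': "K' + m + a = a * m + a * K + 1"
      unfolding K'_def by linarith
    then have "K' \<ge> 1"
      using \<open>m \<le> a * m\<close> \<open>a \<le> a * K\<close> by linarith
    have "\<exists>F c. (\<forall>j<a. F j \<subseteq> S \<and> card (F j) = K \<and> col (F j) = c) \<and> disjoint_family_on F {..<a}"
      if S: "S \<subseteq> V" "card S = K'" for S
    proof -
      have "has_disjoint_monochromatic a K S col"
      proof (rule prime_disjoint_monochromatic[OF factor.hyps(1) factor.prems(1)])
        show "finite S"
          using S factor.prems(2) finite_subset by blast
        show "col F < m" if "F \<subseteq> S" "card F = K" for F
          using that S factor.prems(3) by blast
        show "a * m + a * K + 1 \<le> card S + m + a"
          using K' S by simp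
      qed
      then show ?thesis
        unfolding has_disjoint_monochromatic_def .
    qed
    then obtain G col' where G: "\<And>S j. S \<subseteq> V \<Longrightarrow> card S = K' \<Longrightarrow> j < a \<Longrightarrow>
          G S j \<subseteq> S \<and> card (G S j) = K \<and> col (G S j) = col' S"
      and G_disj: "\<And>S. S \<subseteq> V \<Longrightarrow> card S = K' \<Longrightarrow> disjoint_family_on (G S) {..<a}"
      by metis
    have "has_disjoint_monochromatic b K' V col'"
    proof (rule factor.IH[OF \<open>K' \<ge> 1\<close> factor.prems(2)])
      show "col' S < m" if "S \<subseteq> V" "card S = K'" for S
        using G[OF that, of 0] factor.prems(3)[of "G S 0"] a that by auto
      \<comment> \<open>The thresholds compose exactly: inserting \<open>K'\<close> turns the
        condition for \<open>b\<close> into the one for \<open>a * b\<close>.\<close>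
      have "b * (K' + m + a) = b * (a * m + a * K + 1)"
        using K' by simp
      then show "b * m + b * K' + 1 \<le> card V + m + b"
        using factor.prems(4) by (simp add: algebra_simps)
    qed
    then obtain S c where S: "\<And>j. j < b \<Longrightarrow> S j \<subseteq> V \<and> card (S j) = K' \<and> col' (S j) = c"
      and S_disj: "disjoint_family_on S {..<b}"
      unfolding has_disjoint_monochromatic_def by blast
    \<comment> \<open>The quotient selects a \<open>K'\<close>-set, the remainder one of the
      \<open>a\<close> disjoint \<open>K\<close>-sets inside it.\<close>
    define F where "F j = G (S (j div a)) (j mod a)" for j
    have div: "j div a < b" if "j < a * b" for j
      using that by (simp add: less_mult_imp_div_less mult.commute)
    have F: "F j \<subseteq> S (j div a) \<and> card (F j) = K \<and> col (F j) = c" if "j < a * b" for j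
      using G[of "S (j div a)" "j mod a"] S[OF div[OF that]] a by (simp add: F_def)
    have "disjoint_family_on F {..<a * b}"
      unfolding disjoint_family_on_def
    proof (intro ballI impI)
      fix i j assume ij: "i \<in> {..<a * b}" "j \<in> {..<a * b}" "i \<noteq> j"
      show "F i \<inter> F j = {}"
      proof (cases "i div a = j div a")
        case True
        then have "i mod a \<noteq> j mod a"
          using ij(3) by (metis div_mult_mod_eq)
        then show ?thesis
          using G_disj[of "S (i div a)"] S[OF div, of i] ij a True
          by (auto simp: F_def disjoint_family_on_def)
      next
        case False
        then have "S (i div a) \<inter> S (j div a) = {}"
          using S_disj div ij by (auto simp: disjoint_family_on_def)
        then show ?thesis
          using F[of i] F[of j] ij by blast
      qed
    qed
    moreover have "F j \<subseteq> V" if "j < a * b" for j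
      using F[OF that] S[OF div[OF that]] by blast
    ultimately show ?thesis
      unfolding has_disjoint_monochromatic_def
      by (intro exI[of _ F] exI[of _ c]) (use F in simp)
  qed
qed

section \<open>The random Kneser hypergraph\<close>

lemma prob_Pi_pmf_bernoulli_all_False:
  assumes "finite A" "E \<subseteq> A" "0 \<le> \<rho>" "\<rho> \<le> 1"
  shows "measure_pmf.prob (Pi_pmf A dflt (\<lambda>_. bernoulli_pmf \<rho>)) {b. \<forall>x\<in>E. \<not> b x} = (1 - \<rho>) ^ card E"
proof -
  have "{b. \<forall>x\<in>E. \<not> b x} = Pi A (\<lambda>x. if x \<in> E then {False} else UNIV)"
    using assms(2) by (auto simp: Pi_def)
  then have "measure_pmf.prob (Pi_pmf A dflt (\<lambda>_. bernoulli_pmf \<rho>)) {b. \<forall>x\<in>E. \<not> b x}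
      = (\<Prod>x\<in>A. measure_pmf.prob (bernoulli_pmf \<rho>) (if x \<in> E then {False} else UNIV))"
    using measure_Pi_pmf_Pi[OF assms(1)] by simp
  also have "\<dots> = (\<Prod>x\<in>A. if x \<in> E then 1 - \<rho> else 1)"
    using assms(3,4) by (intro prod.cong) (auto simp: measure_pmf_single)
  also have "\<dots> = (1 - \<rho>) ^ card E"
    using assms(1,2) by (simp add: prod.If_cases Int_absorb1)
  finally show ?thesis .
qed

text \<open>An integer below a ceiling is below the number itself, so otherwise all classes would be
  smaller than average.\<close>

lemma pigeonhole_ceiling:
  fixes f :: "'a \<Rightarrow> nat"
  assumes "finite S" "f ` S \<subseteq> {..<m}" "m > 0"
  shows "\<exists>i<m. \<lceil>real (card S) / real m\<rceil> \<le> int (card {x\<in>S. f x = i})"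
proof (rule ccontr)
  assume "\<not> ?thesis"
  then have "real (card {x\<in>S. f x = i}) < real (card S) / real m" if "i < m" for i
    using that by (force simp: not_le less_ceiling_iff)
  then have "(\<Sum>i<m. real (card {x\<in>S. f x = i})) < (\<Sum>i<m. real (card S) / real m)"
    using assms(3) by (intro sum_strict_mono) auto
  also have "\<dots> = real (card S)"
    using assms(3) by simp
  also have "real (card S) = (\<Sum>i<m. real (card {x\<in>S. f x = i}))"
    using sum_fun_comp[OF assms(1) _ assms(2), of "\<lambda>_. 1"] by simp
  finally show False by simp
qed

lemma finite_kneser_vertices [simp]: "finite (kneser_vertices n k)"
  by (rule finite_subset[of _ "Pow {1..n}"]) (auto simp: kneser_vertices_def)

lemma finite_kneser_edges [simp]: "finite (kneser_edges r n k)"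
  by (rule finite_subset[of _ "Pow (kneser_vertices n k)"]) (auto simp: kneser_edges_def)

lemma card_kneser_vertices: "card (kneser_vertices n k) = n choose k"
  using n_subsets[of "{1..n}" k] by (simp add: kneser_vertices_def)

section \<open>Counting the configurations of absent edges\<close>

definition disjoint_tuples :: "nat \<Rightarrow> nat \<Rightarrow> nat \<Rightarrow> (nat \<Rightarrow> nat set) set" where
  "disjoint_tuples r n K = {S \<in> {..<r} \<rightarrow>\<^sub>E kneser_vertices n K. disjoint_family_on S {..<r}}"

definition subset_families :: "nat \<Rightarrow> nat \<Rightarrow> nat \<Rightarrow> (nat \<Rightarrow> nat set) \<Rightarrow> (nat \<Rightarrow> nat set set) set" where
  "subset_families r k t S =
     (\<Pi>\<^sub>E j\<in>{..<r}. {T. T \<subseteq> {e. e \<subseteq> S j \<and> card e = k} \<and> card T = t})"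

definition transversals :: "nat \<Rightarrow> (nat \<Rightarrow> 'a set) \<Rightarrow> 'a set set" where
  "transversals r T = (\<lambda>f. f ` {..<r}) ` (\<Pi>\<^sub>E j\<in>{..<r}. T j)"

lemma disjoint_tuples_memD:
  assumes "S \<in> disjoint_tuples r n K" "j < r"
  shows "S j \<subseteq> {1..n}" "card (S j) = K" "finite (S j)"
proof -
  have "S j \<in> kneser_vertices n K"
    using assms by (auto simp: disjoint_tuples_def)
  then show "S j \<subseteq> {1..n}" "card (S j) = K" "finite (S j)"
    by (auto simp: kneser_vertices_def intro: finite_subset)
qed

lemma finite_disjoint_tuples: "finite (disjoint_tuples r n K)"
  by (rule finite_subset[of _ "{..<r} \<rightarrow>\<^sub>E kneser_vertices n K"])
    (auto simp: disjoint_tuples_def intro: finite_PiE)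

lemma card_disjoint_tuples_le_binomial: "card (disjoint_tuples r n K) \<le> (n choose K) ^ r"
proof -
  have "card (disjoint_tuples r n K) \<le> card ({..<r} \<rightarrow>\<^sub>E kneser_vertices n K)"
    by (rule card_mono) (auto simp: disjoint_tuples_def intro: finite_PiE)
  then show ?thesis
    by (simp add: card_funcsetE card_kneser_vertices)
qed

text \<open>A tuple is determined by the map that sends each point to the index of the set
  containing it, or to \<open>r\<close> if there is none. This count serves condition (I).\<close>

lemma card_disjoint_tuples_le_power: "card (disjoint_tuples r n K) \<le> (r + 1) ^ n"
proof -
  let ?h = "\<lambda>f. \<lambda>j\<in>{..<r}. {x\<in>{1..n}. f x = j}"
  have "disjoint_tuples r n K \<subseteq> ?h ` ({1..n} \<rightarrow>\<^sub>E {..r})"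
  proof
    fix S assume S: "S \<in> disjoint_tuples r n K"
    define f where "f = (\<lambda>x\<in>{1..n}. if \<exists>j<r. x \<in> S j then THE j. j < r \<and> x \<in> S j else r)"
    have f_eq: "f x = j" if "j < r" "x \<in> S j" for x j
    proof -
      have "(THE j. j < r \<and> x \<in> S j) = j"
        using that S by (intro the_equality) (auto simp: disjoint_tuples_def disjoint_family_on_def)
      then show ?thesis
        using that disjoint_tuples_memD(1)[OF S that(1)] by (auto simp: f_def)
    qed
    have f_r: "f x = r" if "\<not> (\<exists>j<r. x \<in> S j)" "x \<in> {1..n}" for x
      using that by (auto simp: f_def)
    have "f \<in> {1..n} \<rightarrow>\<^sub>E {..r}"
    proof (rule PiE_I)
      show "f x \<in> {..r}" if "x \<in> {1..n}" for x
        using f_eq[of _ x] f_r[of x] that by (cases "\<exists>j<r. x \<in> S j") auto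
    qed (simp only: f_def restrict_apply if_False)
    moreover have "S = ?h f"
    proof
      fix j
      show "S j = ?h f j"
      proof (cases "j < r")
        case True
        have "x \<in> S j \<longleftrightarrow> x \<in> {1..n} \<and> f x = j" for x
        proof
          assume "x \<in> S j"
          then show "x \<in> {1..n} \<and> f x = j"
            using f_eq[OF True] disjoint_tuples_memD(1)[OF S True] by blast
        next
          assume x: "x \<in> {1..n} \<and> f x = j"
          then obtain i where "i < r" "x \<in> S i"
            using f_r[of x] True by blast
          then show "x \<in> S j"
            using f_eq[of i x] x by simp
        qed
        then show ?thesis
          using True by auto
      next
        case False
        then show ?thesis
          using S by (auto simp: disjoint_tuples_def)
      qed
    qed
    ultimately show "S \<in> ?h ` ({1..n} \<rightarrow>\<^sub>E {..r})"
      by blast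
  qed
  then have "card (disjoint_tuples r n K) \<le> card ({1..n} \<rightarrow>\<^sub>E {..r})"
    by (meson card_image_le card_mono finite_PiE finite_atLeastAtMost finite_atMost finite_imageI order_trans)
  then show ?thesis
    by (simp add: card_funcsetE)
qed

lemma finite_subset_families:
  assumes "S \<in> disjoint_tuples r n K"
  shows "finite (subset_families r k t S)"
  unfolding subset_families_def
proof (rule finite_PiE)
  fix j assume "j \<in> {..<r}"
  then have "finite (S j)"
    using disjoint_tuples_memD(3)[OF assms] by simp
  then show "finite {T. T \<subseteq> {e. e \<subseteq> S j \<and> card e = k} \<and> card T = t}"
    by - (rule finite_subset[of _ "Pow (Pow (S j))"], auto)
qed simp

lemma card_subset_families:
  assumes "S \<in> disjoint_tuples r n K"
  shows "card (subset_families r k t S) = ((K choose k) choose t) ^ r"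
proof -
  have "card {T. T \<subseteq> {e. e \<subseteq> S j \<and> card e = k} \<and> card T = t} = (K choose k) choose t"
    if "j < r" for j
  proof -
    note S = disjoint_tuples_memD[OF assms that]
    have "finite {e. e \<subseteq> S j \<and> card e = k}"
      using S(3) by - (rule finite_subset[of _ "Pow (S j)"], auto)
    then show ?thesis
      using n_subsets[OF S(3), of k] S(2) by (simp add: n_subsets)
  qed
  then show ?thesis
    unfolding subset_families_def by (simp add: card_PiE)
qed

text \<open>As \<open>k \<ge> 1\<close>, the \<open>k\<close>-sets are nonempty, so none lies in two
  of the families \<open>T j\<close>. A transversal therefore has \<open>r\<close> members and
  determines its choice function.\<close>

lemma transversals_kneser:
  assumes S: "S \<in> disjoint_tuples r n K" and T: "T \<in> subset_families r k t S" and k: "k \<ge> 1"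
  shows "transversals r T \<subseteq> kneser_edges r n k" "card (transversals r T) = t ^ r"
proof -
  have T': "e \<subseteq> S j" "card e = k" "e \<noteq> {}" if "j < r" "e \<in> T j" for j e
  proof -
    have "T j \<subseteq> {e. e \<subseteq> S j \<and> card e = k}"
      using PiE_mem[OF T[unfolded subset_families_def], of j] that(1) by simp
    then show "e \<subseteq> S j" "card e = k" "e \<noteq> {}"
      using that k by auto
  qed
  have card_T: "card (T j) = t" if "j < r" for j
    using PiE_mem[OF T[unfolded subset_families_def], of j] that by simp
  have disj: "S i \<inter> S j = {}" if "i < r" "j < r" "i \<noteq> j" for i j
    using S that by (auto simp: disjoint_tuples_def disjoint_family_on_def)
  have eq: "i = j" if "e \<in> T i" "e \<in> T j" "i < r" "j < r" for e i j
    using T'[of i e] T'[of j e] disj[of i j] that by blast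
  show "transversals r T \<subseteq> kneser_edges r n k"
  proof
    fix E assume "E \<in> transversals r T"
    then obtain f where f: "f \<in> (\<Pi>\<^sub>E j\<in>{..<r}. T j)" and E: "E = f ` {..<r}"
      by (auto simp: transversals_def)
    have fT: "f j \<in> T j" if "j < r" for j
      using f that by auto
    have "inj_on f {..<r}"
      using fT eq by (intro inj_onI) (metis lessThan_iff)
    then have "card E = r"
      by (simp add: E card_image)
    moreover have "E \<subseteq> kneser_vertices n k"
      using fT T' disjoint_tuples_memD(1)[OF S] by (fastforce simp: E kneser_vertices_def)
    moreover have "pairwise disjnt E"
      unfolding pairwise_def
    proof (intro ballI impI)
      fix a b assume ab: "a \<in> E" "b \<in> E" "a \<noteq> b"
      then obtain i j where "a = f i" "b = f j" "i < r" "j < r" "i \<noteq> j"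
        by (auto simp: E)
      then show "disjnt a b"
        using T'(1)[OF _ fT, of i] T'(1)[OF _ fT, of j] disj[of i j] by (auto simp: disjnt_def)
    qed
    ultimately show "E \<in> kneser_edges r n k"
      by (simp add: kneser_edges_def)
  qed
  have "inj_on (\<lambda>f. f ` {..<r}) (\<Pi>\<^sub>E j\<in>{..<r}. T j)"
  proof (rule inj_onI)
    fix f f' assume f: "f \<in> (\<Pi>\<^sub>E j\<in>{..<r}. T j)" "f' \<in> (\<Pi>\<^sub>E j\<in>{..<r}. T j)"
      and im: "f ` {..<r} = f' ` {..<r}"
    show "f = f'"
    proof (rule PiE_ext[OF f])
      fix j assume j: "j \<in> {..<r}"
      then obtain i where i: "i < r" "f j = f' i"
        using im by (metis imageE imageI lessThan_iff)
      then have "f j \<in> T j" "f j \<in> T i"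
        using PiE_mem[OF f(1), of j] PiE_mem[OF f(2), of i] j by auto
      then show "f j = f' j"
        using eq i j by auto
    qed
  qed
  then have "card (transversals r T) = card (\<Pi>\<^sub>E j\<in>{..<r}. T j)"
    unfolding transversals_def by (rule card_image)
  also have "\<dots> = t ^ r"
    using card_T by (simp add: card_PiE)
  finally show "card (transversals r T) = t ^ r" .
qed

text \<open>All members of the chosen families have the same colour, so any transversal present
  would be a monochromatic edge.\<close>

lemma ex_absent_transversals:
  assumes k: "k \<ge> 1" and m: "m > 0"
    and n: "r * m + r * (k + l) + 1 \<le> n + m + r"
    and t: "int t = \<lceil>real ((k + l) choose k) / real m\<rceil>"
    and c: "proper_coloring (kneser_vertices n k, {E \<in> kneser_edges r n k. b E}) m c"
  shows "\<exists>S\<in>disjoint_tuples r n (k + l). \<exists>T\<in>subset_families r k t S.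
    \<forall>E\<in>transversals r T. \<not> b E"
proof -
  define popular where "popular S i \<longleftrightarrow> i < m \<and> t \<le> card {e. e \<subseteq> S \<and> card e = k \<and> c e = i}" for S i
  define col where "col S = (SOME i. popular S i)" for S
  have col: "popular S (col S)" if S: "S \<subseteq> {1..n}" "card S = k + l" for S
  proof -
    have "finite S"
      using S finite_subset by blast
    let ?P = "{e. e \<subseteq> S \<and> card e = k}"
    have "finite ?P"
      using \<open>finite S\<close> by - (rule finite_subset[of _ "Pow S"], auto)
    moreover have "c ` ?P \<subseteq> {..<m}"
      using c S by (auto simp: proper_coloring_def kneser_vertices_def)
    ultimately obtain i where "i < m" "\<lceil>real (card ?P) / real m\<rceil> \<le> int (card {x\<in>?P. c x = i})"
      using pigeonhole_ceiling[of ?P c m] m by auto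
    then have "popular S i"
      using n_subsets[OF \<open>finite S\<close>, of k] S t by (simp add: popular_def)
    then show ?thesis
      unfolding col_def by (rule someI)
  qed
  have "has_disjoint_monochromatic r (k + l) {1..n} col"
    using k n col by (intro disjoint_monochromatic[where m = m]) (auto simp: popular_def)
  then obtain F i where F: "\<And>j. j < r \<Longrightarrow> F j \<subseteq> {1..n} \<and> card (F j) = k + l \<and> col (F j) = i"
    "disjoint_family_on F {..<r}"
    unfolding has_disjoint_monochromatic_def by blast
  define S where "S = restrict F {..<r}"
  have S: "S \<in> disjoint_tuples r n (k + l)"
    using F by (auto simp: S_def disjoint_tuples_def kneser_vertices_def disjoint_family_on_def)
  have "\<exists>T. T \<subseteq> {e. e \<subseteq> S j \<and> card e = k \<and> c e = i} \<and> card T = t" if "j < r" for j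
  proof -
    have "t \<le> card {e. e \<subseteq> S j \<and> card e = k \<and> c e = i}"
      using F(1)[OF that] col[of "F j"] that by (auto simp: S_def popular_def)
    then show ?thesis
      by (meson obtain_subset_with_card_n)
  qed
  then obtain T where T: "\<And>j. j < r \<Longrightarrow> T j \<subseteq> {e. e \<subseteq> S j \<and> card e = k \<and> c e = i} \<and> card (T j) = t"
    by metis
  have T': "restrict T {..<r} \<in> subset_families r k t S"
    using T by (fastforce simp: subset_families_def)
  moreover have "\<not> b E" if E: "E \<in> transversals r (restrict T {..<r})" for E
  proof
    assume "b E"
    obtain f where f: "f \<in> (\<Pi>\<^sub>E j\<in>{..<r}. restrict T {..<r} j)" "E = f ` {..<r}"
      using E by (auto simp: transversals_def)
    have "c e = i" if e: "e \<in> E" for e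
    proof -
      obtain j where "j < r" "e = f j"
        using e f(2) by blast
      then have "e \<in> T j"
        using PiE_mem[OF f(1), of j] by simp
      then show ?thesis
        using T[OF \<open>j < r\<close>] by blast
    qed
    moreover have "E \<in> kneser_edges r n k"
      using transversals_kneser(1)[OF S T' k] E by blast
    ultimately show False
      using c \<open>b E\<close> unfolding proper_coloring_def by auto
  qed
  ultimately show ?thesis
    using S by blast
qed

section \<open>Colourings and the union bound\<close>

lemma ex_proper_coloring:
  assumes "finite V" "\<And>E. E \<in> \<E> \<Longrightarrow> E \<subseteq> V \<and> card E \<ge> 2"
  shows "\<exists>m c. proper_coloring (V, \<E>) m c"
proof -
  obtain c :: "'a \<Rightarrow> nat" and m where c: "c ` V = {i. i < m}" "inj_on c V"
    using finite_imp_inj_to_nat_seg[OF assms(1)] by blast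
  have "\<not> (\<exists>i. \<forall>v\<in>E. c v = i)" if "E \<in> \<E>" for E
  proof
    assume "\<exists>i. \<forall>v\<in>E. c v = i"
    then have "v = w" if "v \<in> E" "w \<in> E" for v w
      using that assms(2)[OF \<open>E \<in> \<E>\<close>] inj_onD[OF c(2), of v w] by (metis subsetD)
    then have "card E \<le> 1"
      by (metis card_le_Suc0_iff_eq One_nat_def card.infinite zero_le)
    then show False
      using assms(2)[OF that] by simp
  qed
  then show ?thesis
    using c(1) unfolding proper_coloring_def by (intro exI[of _ m] exI[of _ c]) auto
qed

lemma proper_coloring_mono: "proper_coloring H m c \<Longrightarrow> m \<le> m' \<Longrightarrow> proper_coloring H m' c"
  unfolding proper_coloring_def by fastforce

text \<open>Edges have at least two vertices, so an injective colouring is proper and the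
  \<open>LEAST\<close> is attained; extra colours do no harm.\<close>

lemma ex_coloring_if_chromatic_number_le:
  assumes "r \<ge> 2" "chromatic_number (kneser_vertices n k, {E \<in> kneser_edges r n k. b E}) \<le> m"
  shows "\<exists>c. proper_coloring (kneser_vertices n k, {E \<in> kneser_edges r n k. b E}) m c"
proof -
  let ?H = "(kneser_vertices n k, {E \<in> kneser_edges r n k. b E})"
  have "\<exists>m c. proper_coloring ?H m c"
    using assms(1) by (intro ex_proper_coloring) (auto simp: kneser_edges_def)
  then have "\<exists>c. proper_coloring ?H (chromatic_number ?H) c"
    unfolding chromatic_number_def by (rule LeastI_ex)
  then show ?thesis
    using assms(2) proper_coloring_mono by blast
qed

text \<open>A union bound over the pairs of a tuple and its families; each pair asks for
  \<open>t ^ r\<close> distinct independent edges to be absent.\<close>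

lemma prob_chromatic_number_le:
  assumes k: "k \<ge> 1" and r: "r \<ge> 2" and m: "m > 0" and rho: "0 \<le> \<rho>" "\<rho> \<le> 1"
    and n: "r * m + r * (k + l) + 1 \<le> n + m + r"
    and t: "int t = \<lceil>real ((k + l) choose k) / real m\<rceil>"
  shows "measure_pmf.prob (random_kneser r n k \<rho>) {H. chromatic_number H \<le> m}
    \<le> real (card (disjoint_tuples r n (k + l))) * real (((k + l) choose k) choose t) ^ r
      * (1 - \<rho>) ^ (t ^ r)"
proof -
  define M where "M = Pi_pmf (kneser_edges r n k) False (\<lambda>_. bernoulli_pmf \<rho>)"
  define absent where "absent T = {b :: nat set set \<Rightarrow> bool. \<forall>E\<in>transversals r T. \<not> b E}" for T
  let ?D = "disjoint_tuples r n (k + l)" and ?Fam = "subset_families r k t"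
  have fin: "finite (Sigma ?D ?Fam)"
    using finite_disjoint_tuples finite_subset_families by (intro finite_SigmaI) auto
  have "measure_pmf.prob (random_kneser r n k \<rho>) {H. chromatic_number H \<le> m}
      = measure_pmf.prob M {b. chromatic_number (kneser_vertices n k, {E \<in> kneser_edges r n k. b E}) \<le> m}"
    unfolding random_kneser_def M_def by (simp add: vimage_def)
  also have "\<dots> \<le> measure_pmf.prob M (\<Union>(S, T)\<in>Sigma ?D ?Fam. absent T)"
  proof (rule measure_pmf.finite_measure_mono)
    show "{b. chromatic_number (kneser_vertices n k, {E \<in> kneser_edges r n k. b E}) \<le> m}
        \<subseteq> (\<Union>(S, T)\<in>Sigma ?D ?Fam. absent T)"
    proof
      fix b assume "b \<in> {b. chromatic_number (kneser_vertices n k, {E \<in> kneser_edges r n k. b E}) \<le> m}"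
      then obtain c where "proper_coloring (kneser_vertices n k, {E \<in> kneser_edges r n k. b E}) m c"
        using ex_coloring_if_chromatic_number_le[OF r] by blast
      then show "b \<in> (\<Union>(S, T)\<in>Sigma ?D ?Fam. absent T)"
        using ex_absent_transversals[OF k m n t, of b c] unfolding absent_def by fastforce
    qed
  qed simp
  also have "\<dots> \<le> (\<Sum>(S, T)\<in>Sigma ?D ?Fam. measure_pmf.prob M (absent T))"
    using measure_pmf.finite_measure_subadditive_finite[OF fin, of "\<lambda>(S, T). absent T" M]
    by (simp add: case_prod_unfold)
  also have "\<dots> = (\<Sum>(S, T)\<in>Sigma ?D ?Fam. (1 - \<rho>) ^ (t ^ r))"
  proof (intro sum.cong refl, clarify)
    fix S T assume "S \<in> ?D" "T \<in> ?Fam S"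
    then show "measure_pmf.prob M (absent T) = (1 - \<rho>) ^ (t ^ r)"
      using transversals_kneser[OF _ _ k] rho unfolding M_def absent_def
      by (subst prob_Pi_pmf_bernoulli_all_False) auto
  qed
  also have "\<dots> = real (card (Sigma ?D ?Fam)) * (1 - \<rho>) ^ (t ^ r)"
    by (simp add: case_prod_unfold)
  also have "card (Sigma ?D ?Fam) = card ?D * (((k + l) choose k) choose t) ^ r"
    using finite_disjoint_tuples finite_subset_families card_subset_families
    by (subst card_SigmaI) auto
  finally show ?thesis
    by simp
qed

section \<open>Exponential estimates and the limit\<close>

lemma power_self_le_fact_exp: "real t ^ t \<le> fact t * exp (real t)"
proof -
  have "(\<lambda>j. real t ^ j /\<^sub>R fact j) sums exp (real t)"
    by (rule exp_converges)
  \<comment> \<open>A single term of the exponential series, all of whose terms are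
    nonnegative.\<close>
  then have "(\<Sum>j\<in>{t}. real t ^ j /\<^sub>R fact j) \<le> exp (real t)"
    unfolding sums_iff using sum_le_suminf[of "\<lambda>j. real t ^ j /\<^sub>R fact j" "{t}"] by auto
  then show ?thesis
    by (simp add: field_simps)
qed

text \<open>The binomial coefficient is at most \<open>(m * t) ^ t / fact t\<close>, and
  \<open>t ^ t / fact t\<close> is at most \<open>exp t\<close>.\<close>

lemma binomial_le_exp:
  assumes "m > 0" "M \<le> m * t"
  shows "real (M choose t) \<le> exp (real t * (1 + ln (real m)))"
proof -
  have "real (M choose t) * fact t \<le> real (M ^ t)"
    using binomial_fact_pow[of M t] by (metis of_nat_fact of_nat_le_iff of_nat_mult)
  also have "\<dots> \<le> real ((m * t) ^ t)"
    using assms(2) by (intro of_nat_mono power_mono) auto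
  also have "\<dots> = real m ^ t * real t ^ t"
    by (simp add: power_mult_distrib)
  also have "\<dots> \<le> real m ^ t * (fact t * exp (real t))"
    by (intro mult_left_mono power_self_le_fact_exp) simp
  finally have "real (M choose t) \<le> real m ^ t * exp (real t)"
    by (simp add: field_simps)
  also have "real m ^ t = exp (real t * ln (real m))"
    using assms(1) by (simp add: exp_of_nat_mult)
  also have "\<dots> * exp (real t) = exp (real t * (1 + ln (real m)))"
    by (simp add: algebra_simps exp_add)
  finally show ?thesis .
qed

text \<open>Uses \<open>1 - \<rho> \<le> exp (- \<rho>)\<close>. The exponent \<open>x\<close> stays
  free so that either count of the tuples can be inserted.\<close>

lemma prob_chromatic_number_le_exp:
  assumes k: "k \<ge> 1" and r: "r \<ge> 2" and m: "m > 0" and rho: "0 \<le> \<rho>" "\<rho> \<le> 1"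
    and n: "r * m + r * (k + l) + 1 \<le> n + m + r"
    and t: "int t = \<lceil>real ((k + l) choose k) / real m\<rceil>"
    and x: "real (card (disjoint_tuples r n (k + l))) \<le> exp x"
  shows "measure_pmf.prob (random_kneser r n k \<rho>) {H. chromatic_number H \<le> m}
    \<le> exp (x + real r * real t * (1 + ln (real m)) - \<rho> * real t ^ r)"
proof -
  have "real ((k + l) choose k) / real m \<le> real_of_int (int t)"
    unfolding t by (rule le_of_int_ceiling)
  then have "real ((k + l) choose k) \<le> real (m * t)"
    using m by (simp add: field_simps)
  then have le: "(k + l) choose k \<le> m * t"
    by linarith
  have "real (((k + l) choose k) choose t) ^ r \<le> exp (real t * (1 + ln (real m))) ^ r"
    by (intro power_mono binomial_le_exp m le) simp
  moreover have "(1 - \<rho>) ^ (t ^ r) \<le> exp (- \<rho>) ^ (t ^ r)"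
    using rho exp_ge_add_one_self[of "- \<rho>"] by (intro power_mono) auto
  ultimately have "real (card (disjoint_tuples r n (k + l))) * real (((k + l) choose k) choose t) ^ r
        * (1 - \<rho>) ^ (t ^ r)
      \<le> exp x * exp (real t * (1 + ln (real m))) ^ r * exp (- \<rho>) ^ (t ^ r)"
    using x rho by (intro mult_mono) auto
  also have "\<dots> = exp (x + real r * real t * (1 + ln (real m)) - \<rho> * real t ^ r)"
    by (simp add: exp_add exp_diff exp_minus field_simps flip: exp_of_nat_mult)
  finally show ?thesis
    using prob_chromatic_number_le[OF k r m rho n t] by linarith
qed

theorem theorem2:
  fixes k r l :: "nat \<Rightarrow> nat" and \<rho> :: "nat \<Rightarrow> real" and d t :: "nat \<Rightarrow> int"
  assumes k_r: "\<forall>\<^sub>F n in sequentially.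
      1 \<le> k n \<and> 2 \<le> r n \<and> real (r n) \<le> real n / real (k n)"
    and rho: "\<forall>\<^sub>F n in sequentially. 0 < \<rho> n \<and> \<rho> n \<le> 1"
    and d: "\<And>n. d n =
      \<lceil>(real n - real (r n) * (real (k n) + real (l n) - 1)) / (real (r n) - 1)\<rceil>"
    and d_ge_2: "\<forall>\<^sub>F n in sequentially. 2 \<le> d n"
    and t: "\<And>n. t n = \<lceil>real ((k n + l n) choose k n) / (real_of_int (d n) - 1)\<rceil>"
    and I_or_II:
      "filterlim (\<lambda>n. real n * ln (real (r n) + 1)
          + real (r n) * real_of_int (t n) * (1 + ln (real_of_int (d n) - 1))
          - \<rho> n * real_of_int (t n) ^ r n) at_bot sequentially
       \<or> filterlim (\<lambda>n. real (r n) * (real (k n) + real (l n)) * (ln (real n) + 1)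
          + real (r n) * real_of_int (t n) * (1 + ln (real_of_int (d n) - 1))
          - \<rho> n * real_of_int (t n) ^ r n) at_bot sequentially"
  shows "(\<lambda>n. measure_pmf.prob (random_kneser (r n) n (k n) (\<rho> n))
            {H. d n \<le> int (chromatic_number H)}) \<longlonglongrightarrow> 1"
proof -
  let ?rest = "\<lambda>n. real (r n) * real_of_int (t n) * (1 + ln (real_of_int (d n) - 1))
    - \<rho> n * real_of_int (t n) ^ r n"
  let ?prob = "\<lambda>n. measure_pmf.prob (random_kneser (r n) n (k n) (\<rho> n))
    {H. d n \<le> int (chromatic_number H)}"
  have prob_ge: "1 - exp (x + ?rest n) \<le> ?prob n"
    if kr: "1 \<le> k n \<and> 2 \<le> r n \<and> real (r n) \<le> real n / real (k n)"
      and \<rho>: "0 < \<rho> n \<and> \<rho> n \<le> 1" and d2: "2 \<le> d n"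
      and x: "real (card (disjoint_tuples (r n) n (k n + l n))) \<le> exp x" for n x
  proof -
    define m where "m = nat (d n - 1)"
    have m: "m > 0" and dm: "d n = int m + 1"
      using d2 by (auto simp: m_def)
    have "int m < \<lceil>(real n - real (r n) * (real (k n) + real (l n) - 1)) / (real (r n) - 1)\<rceil>"
      using d[of n] dm by simp
    \<comment> \<open>An integer below a ceiling is below its argument. Clearing the denominator
      \<open>r n - 1\<close> gives a strict inequality of naturals, which is the size condition with
      its summand 1.\<close>
    then have "real m < (real n - real (r n) * (real (k n) + real (l n) - 1)) / (real (r n) - 1)"
      by (simp add: less_ceiling_iff)
    then have "real m * (real (r n) - 1) < real n - real (r n) * (real (k n) + real (l n) - 1)"
      using kr by (simp add: pos_less_divide_eq)
    then have "real (r n * m + r n * (k n + l n)) < real (n + m + r n)"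
      by (simp add: algebra_simps)
    then have bound: "r n * m + r n * (k n + l n) + 1 \<le> n + m + r n"
      unfolding of_nat_less_iff by simp
    have t_eq: "t n = \<lceil>real ((k n + l n) choose k n) / real m\<rceil>"
      using t[of n] dm by simp
    moreover have "0 \<le> real ((k n + l n) choose k n) / real m"
      by simp
    ultimately have "t n \<ge> 0"
      by linarith
    then have t_nat: "int (nat (t n)) = \<lceil>real ((k n + l n) choose k n) / real m\<rceil>"
      "real_of_int (t n) = real (nat (t n))"
      using t_eq by simp_all
    have "measure_pmf.prob (random_kneser (r n) n (k n) (\<rho> n)) {H. chromatic_number H \<le> m}
        \<le> exp (x + ?rest n)"
      using prob_chromatic_number_le_exp[OF _ _ m _ _ bound t_nat(1) x, of "\<rho> n"] kr \<rho> 
      unfolding t_nat(2) dm by (simp add: add_diff_eq)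
    moreover have "{H. d n \<le> int (chromatic_number H)} = - {H :: nat set hypergraph. chromatic_number H \<le> m}"
      by (auto simp: dm)
    then have "?prob n = 1 - measure_pmf.prob (random_kneser (r n) n (k n) (\<rho> n)) {H. chromatic_number H \<le> m}"
      by (simp add: measure_pmf.prob_compl[of _ "random_kneser (r n) n (k n) (\<rho> n)", simplified] Compl_eq_Diff_UNIV)
    ultimately show ?thesis
      by linarith
  qed
  have conclude: "?prob \<longlonglongrightarrow> 1"
    if lim: "filterlim (\<lambda>n. x n + ?rest n) at_bot sequentially"
      and x: "\<forall>\<^sub>F n in sequentially. real (card (disjoint_tuples (r n) n (k n + l n))) \<le> exp (x n)" for x
  proof (rule tendsto_sandwich)
    show "\<forall>\<^sub>F n in sequentially. 1 - exp (x n + ?rest n) \<le> ?prob n"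
      using k_r rho d_ge_2 x by eventually_elim (rule prob_ge)
    show "\<forall>\<^sub>F n in sequentially. ?prob n \<le> 1"
      by simp
    have "(\<lambda>n. exp (x n + ?rest n)) \<longlonglongrightarrow> 0"
      by (rule filterlim_compose[OF exp_at_bot lim])
    then show "(\<lambda>n. 1 - exp (x n + ?rest n)) \<longlonglongrightarrow> 1"
      using tendsto_diff[OF tendsto_const, of "\<lambda>n. exp (x n + ?rest n)" 0 sequentially 1] by simp
  qed simp
  show ?thesis
    using I_or_II
  proof
    assume "filterlim (\<lambda>n. real n * ln (real (r n) + 1)
          + real (r n) * real_of_int (t n) * (1 + ln (real_of_int (d n) - 1))
          - \<rho> n * real_of_int (t n) ^ r n) at_bot sequentially"
    then show ?thesis
    proof (intro conclude[of "\<lambda>n. real n * ln (real (r n) + 1)"] always_eventually allI)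
      fix n
      have "real (card (disjoint_tuples (r n) n (k n + l n))) \<le> real ((r n + 1) ^ n)"
        using card_disjoint_tuples_le_power of_nat_mono by blast
      also have "\<dots> = exp (real n * ln (real (r n) + 1))"
        by (simp add: exp_of_nat_mult add.commute)
      finally show "real (card (disjoint_tuples (r n) n (k n + l n))) \<le> exp (real n * ln (real (r n) + 1))" .
    qed (simp add: add_diff_eq)
  next
    assume "filterlim (\<lambda>n. real (r n) * (real (k n) + real (l n)) * (ln (real n) + 1)
          + real (r n) * real_of_int (t n) * (1 + ln (real_of_int (d n) - 1))
          - \<rho> n * real_of_int (t n) ^ r n) at_bot sequentially"
    moreover have "\<forall>\<^sub>F n in sequentially. real (card (disjoint_tuples (r n) n (k n + l n)))
        \<le> exp (real (r n) * (real (k n) + real (l n)) * (ln (real n) + 1))"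
      \<comment> \<open>Positive \<open>n\<close> is needed to write its powers as exponentials of
        \<open>ln n\<close>.\<close>
      using eventually_gt_at_top[of 0]
    proof eventually_elim
      case (elim n)
      define K where "K = k n + l n"
      have "n choose K \<le> n ^ K"
        using binomial_le_pow[of K n] by (cases "K \<le> n") (auto simp: binomial_eq_0)
      then have "(n choose K) ^ r n \<le> (n ^ K) ^ r n"
        by (intro power_mono) auto
      then have "card (disjoint_tuples (r n) n K) \<le> n ^ (r n * K)"
        using card_disjoint_tuples_le_binomial[of "r n" n K] by (simp add: power_mult mult.commute)
      then have "real (card (disjoint_tuples (r n) n K)) \<le> real n ^ (r n * K)"
        by (metis of_nat_le_iff of_nat_power)
      also have "\<dots> = exp (real (r n * K) * ln (real n))"
        using elim by (simp add: exp_of_nat_mult del: of_nat_mult)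
      also have "\<dots> \<le> exp (real (r n * K) * (ln (real n) + 1))"
        by (simp add: mult_left_mono)
      finally show ?case
        by (simp add: K_def)
    qed
    ultimately show ?thesis
      by (intro conclude[of "\<lambda>n. real (r n) * (real (k n) + real (l n)) * (ln (real n) + 1)"])
        (simp_all add: add_diff_eq)
  qed
qed

end
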